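(* There is a function $N:\mathbb Z_{>0}\to\mathbb Z_{>0}$ such that the following holds. Let $S_i=C(l_i,p_i)$ with $l_i>p_i$, $i\ge1$, be a nested sequence of finite sublattices monotonically converging to the square lattice $\mathcal S$ such that for each positive integer $k$ there are at least $N(k)$ indices $i$ with $p_i=k$. For each $i$ let $J_i$ be an assignment of coupling constants to the edges of $S_i$ chosen from the distribution $\mathcal J_i$ under which the coupling constants are independent identically distributed mean-zero (nondegenerate) Gaussians, the assignments $J_1,J_2,\dots$ being chosen independently of each other. Then for almost all $(J_i)_{i\ge1}$ there is a converging subsequence $(J_{m_j})_{j\ge1}$ with the following property: if for each $j$, $e_j$ is a c-groundstate in $C(l_{m_j},p_{m_j})$ and $o_j$ is a c-groundstate in $C(l_{m_j}-1,p_{m_j})$ (both with coupling constants given by $J_{m_j}$), then both sequences $(o_j)$ and $(e_j)$ converge and their limits $o,e$ are finitely incongruent states of $\mathcal S$ (with coupling constants given by the limit of $(J_{m_j})$).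
   Context: $\mathcal S$ is the square lattice with vertex set $\mathbb Z^2$ and nearest-neighbour edges. For positive integers $n,k$, $C(n,k)$ is the induced subgraph of $\mathcal S$ on the vertices $(i,j)$ with $|i|\le k$, $|j|\le n$; its boundary is its outer boundary cycle. Each edge $\{i,j\}$ carries a coupling constant $J_{ij}$. A state (spin assignment) on a graph $(V,E)$ is a map $\sigma:V\to\{\pm1\}$; its energy, for a finite graph, is $E(\sigma)=-\sum_{\{i,j\}\in E}J_{ij}\sigma_i\sigma_j$. An edge $ij$ is satisfied by $\sigma$ if $J_{ij}\sigma_i\sigma_j>0$. A c-groundstate of $C(n,k)$ is a state of minimum energy subject to the boundary condition that the spins along the boundary are fixed so that the maximum possible number of boundary edges is satisfied (all of them if the number of boundary edges with negative coupling constant is even, all but one otherwise). A nested sequence of finite sublattices converges to $\mathcal S$ if its union is $\mathcal S$. A sequence of coupling constant assignments on such sublattices converges if it converges on each edge of $\mathcal S$. States are considered up to global reversal of all spins; a sequence of states on finite sublattices converges if for every edge $ij$ of $\mathcal S$ the product $\sigma_i\sigma_j$ is eventually constant. The domain walls between two states of $\mathcal S$ are the connected components, in the dual lattice (vertices are the unit squares; the dual edge $e^*$ of an edge $e$ joins the two unit squares containing $e$), of the set of (duals of) edges satisfied by exactly one of the two states. Two states are finitely incongruent if at least one domain wall between them contains a path that is infinite and unbounded in both ways. *)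

theory Defs
  imports "HOL-Probability.Probability"
begin

type_synonym vertex = "int \<times> int"
type_synonym edge = "vertex set"
type_synonym coupling = "edge \<Rightarrow> real"
type_synonym state = "vertex \<Rightarrow> real"

definition lattice_edges :: "edge set" where
  "lattice_edges = {{u, v} | u v. \<bar>fst u - fst v\<bar> + \<bar>snd u - snd v\<bar> = 1}"

definition induced_edges :: "vertex set \<Rightarrow> edge set" where
  "induced_edges V = {a \<in> lattice_edges. a \<subseteq> V}"

text \<open>The first parameter bounds the second coordinate and the second parameter the first one:
  \<open>C n k\<close> is a strip of width \<open>2k + 1\<close> and height \<open>2n + 1\<close>.\<close>

definition C :: "nat \<Rightarrow> nat \<Rightarrow> vertex set" where
  "C n k = {(i, j). \<bar>i\<bar> \<le> int k \<and> \<bar>j\<bar> \<le> int n}"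

text \<open>The edges of the outer boundary cycle: those contained in one of the four sides.\<close>

definition boundary_edges :: "nat \<Rightarrow> nat \<Rightarrow> edge set" where
  "boundary_edges n k =
     {a \<in> induced_edges (C n k).
        (\<forall>(i, j)\<in>a. \<bar>i\<bar> = int k) \<or> (\<forall>(i, j)\<in>a. \<bar>j\<bar> = int n)}"

definition nested_exhaustion :: "(nat \<Rightarrow> vertex set) \<Rightarrow> bool" where
  "nested_exhaustion V \<longleftrightarrow>
     mono V \<and> (\<Union>i. V i) = UNIV \<and> (\<Union>i. induced_edges (V i)) = lattice_edges"

definition states :: "vertex set \<Rightarrow> state set" where
  "states V = V \<rightarrow>\<^sub>E {-1, 1}"

definition spin_product :: "state \<Rightarrow> edge \<Rightarrow> real" where
  "spin_product s a = (\<Prod>v\<in>a. s v)"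

definition satisfied :: "coupling \<Rightarrow> state \<Rightarrow> edge \<Rightarrow> bool" where
  "satisfied J s a \<longleftrightarrow> J a * spin_product s a > 0"

definition energy :: "coupling \<Rightarrow> edge set \<Rightarrow> state \<Rightarrow> real" where
  "energy J E s = - (\<Sum>a\<in>E. J a * spin_product s a)"

text \<open>If the maximum number of satisfiable boundary edges is one less than their total number,
  the unsatisfied boundary edge is not prescribed, so that the energy of a c-groundstate is also
  minimised over its position.\<close>

definition c_admissible :: "coupling \<Rightarrow> nat \<Rightarrow> nat \<Rightarrow> state \<Rightarrow> bool" where
  "c_admissible J n k =
     is_arg_max (\<lambda>s. card {a \<in> boundary_edges n k. satisfied J s a})
       (\<lambda>s. s \<in> states (C n k))"

definition c_groundstate :: "coupling \<Rightarrow> nat \<Rightarrow> nat \<Rightarrow> state \<Rightarrow> bool" where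
  "c_groundstate J n k =
     is_arg_min (energy J (induced_edges (C n k))) (c_admissible J n k)"

text \<open>These notions are used for assignments and states on the members of a nested exhaustion, so
  that each edge of the lattice belongs to all but finitely many of the sublattices. The limit of
  a sequence of states is unique up to reversal of all spins.\<close>

definition couplings_tendsto :: "(nat \<Rightarrow> coupling) \<Rightarrow> coupling \<Rightarrow> bool" where
  "couplings_tendsto J K \<longleftrightarrow> (\<forall>a\<in>lattice_edges. (\<lambda>i. J i a) \<longlonglongrightarrow> K a)"

definition states_tendsto :: "(nat \<Rightarrow> state) \<Rightarrow> state \<Rightarrow> bool" where
  "states_tendsto s t \<longleftrightarrow>
     (\<forall>a\<in>lattice_edges. \<forall>\<^sub>F i in sequentially. spin_product (s i) a = spin_product t a)"

text \<open>A unit square, that is, a vertex of the dual lattice, is represented by its lower left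
  corner.\<close>

definition unit_square :: "vertex \<Rightarrow> vertex set" where
  "unit_square q = {fst q .. fst q + 1} \<times> {snd q .. snd q + 1}"

definition dual_edge :: "edge \<Rightarrow> edge" where
  "dual_edge a = {q. a \<subseteq> unit_square q}"

definition wall_edges :: "coupling \<Rightarrow> state \<Rightarrow> state \<Rightarrow> edge set" where
  "wall_edges J s t = dual_edge ` {a \<in> lattice_edges. satisfied J s a \<noteq> satisfied J t a}"

text \<open>The connected component, as a set of edges, of the vertex \<open>q\<close> in the graph with edge set
  \<open>F\<close>.\<close>

definition edge_component :: "edge set \<Rightarrow> vertex \<Rightarrow> edge set" where
  "edge_component F q = {f \<in> F. \<exists>r\<in>f. (q, r) \<in> {(x, y). {x, y} \<in> F}\<^sup>*}"

definition domain_walls :: "coupling \<Rightarrow> state \<Rightarrow> state \<Rightarrow> edge set set" where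
  "domain_walls J s t = edge_component (wall_edges J s t) ` \<Union> (wall_edges J s t)"

definition finitely_incongruent :: "coupling \<Rightarrow> state \<Rightarrow> state \<Rightarrow> bool" where
  "finitely_incongruent J s t \<longleftrightarrow>
     (\<exists>W\<in>domain_walls J s t. \<exists>g :: int \<Rightarrow> vertex.
        inj g \<and> (\<forall>n. {g n, g (n + 1)} \<in> W) \<and>
        \<not> bounded (g ` {0..}) \<and> \<not> bounded (g ` {..0}))"

definition gaussian_couplings :: "real \<Rightarrow> nat \<Rightarrow> nat \<Rightarrow> coupling measure" where
  "gaussian_couplings \<sigma> n k =
     (\<Pi>\<^sub>M a\<in>induced_edges (C n k). density lborel (\<lambda>x. ennreal (normal_density 0 \<sigma> x)))"

end

theory Submission
  imports Defs
begin

text \<open>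
  The couplings can be chosen, with a probability that depends on the width \<open>k\<close> only, in such a way
  that the groundstates in \<open>C l k\<close> and \<open>C (l - 1) k\<close> are known in a large window around the origin and
  differ there by a wall along the centre column.

  Suppose that all boundary edges can be satisfied. Then a c-groundstate satisfies all of them, and
  the product of the couplings along the upper half of the boundary cycle decides whether the spins
  at \<open>(-k, 0)\<close> and \<open>(k, 0)\<close> agree (\<open>half_product_spins_pos\<close>). Lowering the height from \<open>l\<close> to \<open>l - 1\<close>
  changes this path near the top row. If the product is positive for \<open>l\<close> and negative for \<open>l - 1\<close>, and
  the same holds for the lower halves, then both boundaries can be satisfied, the two sides agree
  for the first rectangle and disagree for the second.

  Suppose moreover that in the rows \<open>\<bar>j\<bar> < k\<close> the couplings are close to those of a ferromagnet whose
  edges across the centre column are weak, and that the edges from these rows to the rows \<open>\<plusminus>k\<close> have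
  couplings near \<open>0\<close>. Then a comparison of energies (\<open>groundstate_on_window\<close>) shows that on these
  rows the groundstate copies the left side to the left half and the right side to the right half.
  So in the limit the groundstate of the taller rectangle becomes constant, that of the lower one
  changes its sign across the centre column, and the wall between them is a vertical line
  (\<open>finitely_incongruent_centre\<close>).

  The requirement on the window concerns a number of couplings that depends on \<open>k\<close> only, and it is
  scaled with the standard deviation. The four sign requirements concern long paths, but each of
  them can be met by reversing one coupling outside the window, and reversing signs preserves the
  law. Therefore the probability of meeting all requirements is at least a number \<open>good_prob k > 0\<close>
  that depends neither on \<open>l\<close> nor on the standard deviation (\<open>good_prob_le\<close>). If the number of
  rectangles of width \<open>k\<close> is large enough in terms of \<open>good_prob k\<close>, then by the Borel-Cantelli lemma
  almost surely all but finitely many widths have a rectangle that meets the requirements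
  (\<open>AE_infinitely_many_good\<close>), and these rectangles form the subsequence.
\<close>

section \<open>Edges of the square lattice\<close>

definition hedge :: "int \<Rightarrow> int \<Rightarrow> edge" where
  "hedge i j = {(i, j), (i + 1, j)}"

definition vedge :: "int \<Rightarrow> int \<Rightarrow> edge" where
  "vedge i j = {(i, j), (i, j + 1)}"

lemma lattice_edges_cases:
  assumes "a \<in> lattice_edges"
  obtains i j where "a = hedge i j" | i j where "a = vedge i j"
proof -
  obtain x y x' y' where a: "a = {(x, y), (x', y')}" and d: "\<bar>x - x'\<bar> + \<bar>y - y'\<bar> = 1"
    using assms by (auto simp: lattice_edges_def)
  from d consider "y = y'" "x' = x + 1" | "y = y'" "x = x' + 1" | "x = x'" "y' = y + 1"
    | "x = x'" "y = y' + 1"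
    by linarith
  then show thesis
    by cases (use that a in \<open>auto simp: hedge_def vedge_def insert_commute\<close>)
qed

lemma hedge_lattice [simp]: "hedge i j \<in> lattice_edges"
  unfolding lattice_edges_def hedge_def
  by (rule CollectI, rule exI[of _ "(i, j)"], rule exI[of _ "(i + 1, j)"]) simp

lemma vedge_lattice [simp]: "vedge i j \<in> lattice_edges"
  unfolding lattice_edges_def vedge_def
  by (rule CollectI, rule exI[of _ "(i, j)"], rule exI[of _ "(i, j + 1)"]) simp

lemma hedge_eq_iff [simp]: "hedge i j = hedge i' j' \<longleftrightarrow> i = i' \<and> j = j'"
  by (auto simp: hedge_def doubleton_eq_iff)

lemma vedge_eq_iff [simp]: "vedge i j = vedge i' j' \<longleftrightarrow> i = i' \<and> j = j'"
  by (auto simp: vedge_def doubleton_eq_iff)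

lemma hedge_neq_vedge [simp]: "hedge i j \<noteq> vedge i' j'" "vedge i' j' \<noteq> hedge i j"
  by (auto simp: hedge_def vedge_def doubleton_eq_iff)

lemma spin_product_pair: "u \<noteq> v \<Longrightarrow> spin_product s {u, v} = s u * s v"
  by (simp add: spin_product_def)

lemma spin_product_hedge [simp]: "spin_product s (hedge i j) = s (i, j) * s (i + 1, j)"
  by (simp add: hedge_def spin_product_pair)

lemma spin_product_vedge [simp]: "spin_product s (vedge i j) = s (i, j) * s (i, j + 1)"
  by (simp add: vedge_def spin_product_pair)

lemma induced_hedge_iff [simp]:
  "hedge i j \<in> induced_edges V \<longleftrightarrow> (i, j) \<in> V \<and> (i + 1, j) \<in> V"
  unfolding induced_edges_def mem_Collect_eq using hedge_lattice by (simp add: hedge_def)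

lemma induced_vedge_iff [simp]:
  "vedge i j \<in> induced_edges V \<longleftrightarrow> (i, j) \<in> V \<and> (i, j + 1) \<in> V"
  unfolding induced_edges_def mem_Collect_eq using vedge_lattice by (simp add: vedge_def)

lemma C_iff [simp]: "(i, j) \<in> C n k \<longleftrightarrow> \<bar>i\<bar> \<le> int k \<and> \<bar>j\<bar> \<le> int n"
  by (simp add: C_def)

lemma finite_induced_edges_C [simp]: "finite (induced_edges (C n k))"
proof -
  have "C n k = {- int k..int k} \<times> {- int n..int n}"
    by (auto simp: C_def)
  then have "finite (Pow (C n k))"
    by simp
  then show ?thesis
    by (rule finite_subset[rotated]) (auto simp: induced_edges_def)
qed

lemma states_values: "s \<in> states V \<Longrightarrow> v \<in> V \<Longrightarrow> s v = 1 \<or> s v = -1"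
  by (auto simp: states_def PiE_iff)

section \<open>The two halves of the boundary cycle\<close>

text \<open>The parameter \<open>h\<close> is a signed height: the path runs from \<open>(-k, 0)\<close> to \<open>(k, 0)\<close> along
  the upper half of the boundary cycle of \<open>C \<bar>h\<bar> k\<close> if \<open>h > 0\<close>, and along the lower half if
  \<open>h < 0\<close>. Clipping a linear function of the time \<open>t\<close> yields each coordinate at once for the three
  straight pieces of the path.\<close>

definition half_boundary :: "nat \<Rightarrow> int \<Rightarrow> nat \<Rightarrow> vertex" where
  "half_boundary k h t =
     (max (- int k) (min (int k) (int t - \<bar>h\<bar> - int k)),
      sgn h * min \<bar>h\<bar> (min (int t) (2 * \<bar>h\<bar> + 2 * int k - int t)))"

definition half_length :: "nat \<Rightarrow> int \<Rightarrow> nat" where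
  "half_length k h = 2 * nat \<bar>h\<bar> + 2 * k"

definition half_edge :: "nat \<Rightarrow> int \<Rightarrow> nat \<Rightarrow> edge" where
  "half_edge k h t = {half_boundary k h t, half_boundary k h (Suc t)}"

definition half_product :: "coupling \<Rightarrow> nat \<Rightarrow> int \<Rightarrow> real" where
  "half_product J k h = (\<Prod>t<half_length k h. J (half_edge k h t))"

lemma half_boundary_ends:
  "half_boundary k h 0 = (- int k, 0)"
  "half_boundary k h (half_length k h) = (int k, 0)"
  by (auto simp: half_boundary_def half_length_def)

lemma half_edge_left:
  assumes "int t < \<bar>h\<bar>"
  shows "half_edge k h t = vedge (- int k) (if 0 < h then int t else - int t - 1)"
  using assms
  by (simp add: half_edge_def half_boundary_def vedge_def doubleton_eq_iff min_absorb1 min_absorb2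
      max_absorb1 max_absorb2 sgn_if)

lemma half_edge_middle:
  assumes "\<bar>h\<bar> \<le> int t" "int t < \<bar>h\<bar> + 2 * int k"
  shows "half_edge k h t = hedge (int t - \<bar>h\<bar> - int k) h"
  using assms
  by (simp add: half_edge_def half_boundary_def hedge_def doubleton_eq_iff min_absorb1 min_absorb2
      max_absorb1 max_absorb2 sgn_mult_abs)

lemma half_edge_right:
  assumes "\<bar>h\<bar> + 2 * int k \<le> int t" "int t < 2 * \<bar>h\<bar> + 2 * int k"
  shows "half_edge k h t = vedge (int k)
    (if 0 < h then 2 * h + 2 * int k - int t - 1 else 2 * h - 2 * int k + int t)"
  using assms
  by (simp add: half_edge_def half_boundary_def vedge_def doubleton_eq_iff min_absorb1 min_absorb2
      max_absorb1 max_absorb2 sgn_if)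

lemma half_edge_cases:
  assumes "t < half_length k h"
  obtains "int t < \<bar>h\<bar>" | "\<bar>h\<bar> \<le> int t" "int t < \<bar>h\<bar> + 2 * int k"
    | "\<bar>h\<bar> + 2 * int k \<le> int t" "int t < 2 * \<bar>h\<bar> + 2 * int k"
  using assms unfolding half_length_def by linarith

lemma half_edge_boundary:
  assumes "\<bar>h\<bar> = int n" "t < half_length k h"
  shows "half_edge k h t \<in> boundary_edges n k"
proof -
  have "half_edge k h t \<in> lattice_edges"
    using assms(2)
    by (cases rule: half_edge_cases)
      (simp_all add: half_edge_left half_edge_middle half_edge_right)
  moreover have "half_edge k h t \<subseteq> C n k \<and>
    ((\<forall>v\<in>half_edge k h t. \<bar>fst v\<bar> = int k) \<or> (\<forall>v\<in>half_edge k h t. \<bar>snd v\<bar> = int n))"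
    using assms(2)
  proof (cases rule: half_edge_cases)
    case 1
    then show ?thesis
      using assms(1) unfolding half_edge_left[OF 1]
      by (auto simp: vedge_def)
  next
    case 2
    then show ?thesis
      using assms(1) unfolding half_edge_middle[OF 2]
      by (auto simp: hedge_def)
  next
    case 3
    then show ?thesis
      using assms(1) unfolding half_edge_right[OF 3]
      by (auto simp: vedge_def)
  qed
  ultimately show ?thesis
    by (auto simp: boundary_edges_def induced_edges_def case_prod_beta)
qed

lemma boundary_edge_cases:
  assumes "0 < k" "0 < n" "a \<in> boundary_edges n k"
  obtains h t where "\<bar>h\<bar> = int n" "t < half_length k h" "a = half_edge k h t"
proof -
  have a: "a \<in> lattice_edges" "a \<subseteq> C n k"
    "(\<forall>v\<in>a. \<bar>fst v\<bar> = int k) \<or> (\<forall>v\<in>a. \<bar>snd v\<bar> = int n)"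
    using assms(3) by (auto simp: boundary_edges_def induced_edges_def case_prod_beta)
  from a(1) show thesis
  proof (cases rule: lattice_edges_cases)
    case (1 i j)
    have j: "\<bar>j\<bar> = int n" and i: "- int k \<le> i" "i < int k"
      using a(2,3) assms(1) by (auto simp: 1 hedge_def)
    have t: "int (nat (i + int k + int n)) = i + int k + int n"
      using i by simp
    show thesis
    proof (rule that[OF j, of "nat (i + int k + int n)"])
      show "nat (i + int k + int n) < half_length k j"
        using i j by (simp add: half_length_def)
      show "a = half_edge k j (nat (i + int k + int n))"
        using i j t by (subst half_edge_middle) (simp_all add: 1)
    qed
  next
    case (2 i j)
    have i: "i = int k \<or> i = - int k" and j: "- int n \<le> j" "j < int n"
      using a(2,3) assms by (auto simp: 2 vedge_def)
    define h where "h = (if 0 \<le> j then int n else - int n)"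
    define t where "t = (if i = int k
      then (if 0 \<le> j then 2 * n + 2 * k - Suc (nat j) else 2 * n + 2 * k - nat (- j))
      else (if 0 \<le> j then nat j else nat (- j) - 1))"
    have t: "int t = (if i = int k
      then (if 0 \<le> j then 2 * int n + 2 * int k - 1 - j else 2 * int n + 2 * int k + j)
      else (if 0 \<le> j then j else - j - 1))"
      using i j by (auto simp: t_def)
    have h: "\<bar>h\<bar> = int n"
      by (simp add: h_def)
    show thesis
    proof (rule that[OF h, of t])
      show "t < half_length k h"
        unfolding half_length_def h using i j t assms(1) by (auto split: if_splits)
      show "a = half_edge k h t"
      proof (cases "i = int k")
        case True
        then show ?thesis
          using j h by (subst half_edge_right) (auto simp: 2 t h_def)
      next
        case False
        then show ?thesis
          using i j h by (subst half_edge_left) (auto simp: 2 t h_def)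
      qed
    qed
  qed
qed

lemma half_boundary_Suc_neq:
  assumes "t < half_length k h"
  shows "half_boundary k h t \<noteq> half_boundary k h (Suc t)"
proof
  assume eq: "half_boundary k h t = half_boundary k h (Suc t)"
  have "half_edge k h t \<in> lattice_edges"
    using half_edge_boundary[of h "nat \<bar>h\<bar>", OF _ assms]
    by (simp add: boundary_edges_def induced_edges_def)
  moreover obtain x y where "half_boundary k h (Suc t) = (x, y)"
    by fastforce
  ultimately show False
    unfolding half_edge_def eq by (auto simp: lattice_edges_def doubleton_eq_iff)
qed

text \<open>Each half boundary crosses the centre column exactly once, so the sign of a half product can be
  changed by changing the sign of that one coupling.\<close>

lemma half_edge_eq_hedge_iff:
  assumes "t < half_length k h"
  shows "half_edge k h t = hedge 0 j \<longleftrightarrow> t = nat \<bar>h\<bar> + k \<and> 0 < k \<and> j = h"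
  using assms
proof (cases rule: half_edge_cases)
  case 1
  then show ?thesis
    unfolding half_edge_left[OF 1] by auto
next
  case 2
  then show ?thesis
    unfolding half_edge_middle[OF 2] by auto
next
  case 3
  then show ?thesis
    unfolding half_edge_right[OF 3] by auto
qed

section \<open>States satisfying the whole boundary\<close>

text \<open>Multiplying the products \<open>J a * spin_product s a > 0\<close> along a half boundary, all inner spins
  occur twice and cancel. Hence the half product decides whether the spins in the middle of the
  left and the right side agree.\<close>

lemma half_product_spins_pos:
  assumes s: "\<forall>v\<in>C n k. s v = 1 \<or> s v = -1"
    and h: "\<bar>h\<bar> = int n"
    and sat: "\<forall>a\<in>boundary_edges n k. satisfied J s a"
  shows "0 < half_product J k h * (s (- int k, 0) * s (int k, 0))"
proof -
  define f where "f t = s (half_boundary k h t)" for t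
  have step: "half_edge k h t \<subseteq> C n k" "0 < J (half_edge k h t) * (f t * f (Suc t))"
    if "t < half_length k h" for t
  proof -
    have b: "half_edge k h t \<in> boundary_edges n k"
      using half_edge_boundary[OF h that] .
    then show "half_edge k h t \<subseteq> C n k"
      by (simp add: boundary_edges_def induced_edges_def)
    show "0 < J (half_edge k h t) * (f t * f (Suc t))"
      using sat b half_boundary_Suc_neq[OF that]
      by (auto simp: satisfied_def half_edge_def spin_product_pair f_def)
  qed
  have "(\<Prod>t<m. J (half_edge k h t)) * (f 0 * f m) > 0" if "m \<le> half_length k h" for m
    using that
  proof (induction m)
    case 0
    have "half_boundary k h 0 \<in> C n k"
      by (simp add: half_boundary_ends)
    then show ?case
      using s by (auto simp: f_def)
  next
    case (Suc m)
    have "half_boundary k h m \<in> C n k"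
      using step(1)[of m] Suc.prems by (auto simp: half_edge_def)
    then have "f m * f m = 1"
      using s by (auto simp: f_def)
    moreover have "0 < ((\<Prod>t<m. J (half_edge k h t)) * (f 0 * f m)) *
        (J (half_edge k h m) * (f m * f (Suc m)))"
      by (rule mult_pos_pos) (use Suc step(2)[of m] in auto)
    moreover have "((\<Prod>t<m. J (half_edge k h t)) * (f 0 * f m)) *
        (J (half_edge k h m) * (f m * f (Suc m))) =
        (\<Prod>t<Suc m. J (half_edge k h t)) * (f 0 * f (Suc m)) * (f m * f m)"
      by (simp add: algebra_simps)
    ultimately show ?case
      by simp
  qed
  from this[of "half_length k h"] show ?thesis
    by (simp add: half_product_def f_def half_boundary_ends)
qed

text \<open>The time at which a half boundary of \<open>C n k\<close> visits a boundary vertex, so that a spin assignment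
  on the boundary can be given as a function of the time.\<close>

definition half_index :: "nat \<Rightarrow> nat \<Rightarrow> vertex \<Rightarrow> nat" where
  "half_index n k v =
     nat (if fst v = - int k then \<bar>snd v\<bar>
          else if \<bar>snd v\<bar> = int n then int n + int k + fst v
          else 2 * int n + 2 * int k - \<bar>snd v\<bar>)"

lemma half_index_half_boundary:
  assumes "0 < k" "0 < n" "\<bar>h\<bar> = int n" "t \<le> half_length k h"
  shows "half_index n k (half_boundary k h t) = t"
proof -
  consider "int t < \<bar>h\<bar>" | "\<bar>h\<bar> \<le> int t" "int t < \<bar>h\<bar> + 2 * int k"
    | "\<bar>h\<bar> + 2 * int k \<le> int t" "int t \<le> 2 * \<bar>h\<bar> + 2 * int k"
    using assms(4) unfolding half_length_def by linarith
  moreover have "h = int n \<or> h = - int n"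
    using assms(3) by linarith
  ultimately show ?thesis
    using assms(1,2)
    by (cases; elim disjE) (auto simp: half_index_def half_boundary_def min_absorb1 min_absorb2
      max_absorb1 max_absorb2 abs_mult sgn_if)
qed

text \<open>Starting with the spin \<open>1\<close> at \<open>(-k, 0)\<close>, satisfying the edges one after the other determines the
  spins along either half. The two halves meet again at \<open>(k, 0)\<close>, where they agree because
  their products have the same sign.\<close>

lemma boundary_satisfiable:
  assumes k: "0 < k" and n: "0 < n"
    and up: "0 < \<tau> * half_product J k (int n)" and down: "0 < \<tau> * half_product J k (- int n)"
  shows "\<exists>s\<in>states (C n k). \<forall>a\<in>boundary_edges n k. satisfied J s a"
proof -
  \<comment> \<open>Unlike \<open>sgn\<close>, this is never \<open>0\<close>, so that the products below are spins for every \<open>t\<close>.\<close>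
  define \<epsilon> where "\<epsilon> x = (if x < 0 then -1 else 1 :: real)" for x :: real
  define f where "f h t = (\<Prod>u<t. \<epsilon> (J (half_edge k h u)))" for h t
  have \<epsilon>: "\<epsilon> x = 1 \<or> \<epsilon> x = -1" "\<epsilon> x * \<epsilon> x = 1" for x
    by (auto simp: \<epsilon>_def)
  have f: "f h t = 1 \<or> f h t = -1" for h t
    unfolding f_def by (induction t) (use \<epsilon>(1) in force)+
  have nz: "J (half_edge k h t) \<noteq> 0" if "h = int n \<or> h = - int n" "t < half_length k h" for h t
  proof -
    have "half_product J k h \<noteq> 0"
      using up down that(1) by auto
    then show ?thesis
      using that(2) by (auto simp: half_product_def)
  qed
  have f_end: "0 < \<tau> * f h (half_length k h)" if h: "h = int n \<or> h = - int n" for h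
  proof -
    have "0 < x * \<epsilon> x" if "x \<noteq> 0" for x
      using that by (auto simp: \<epsilon>_def)
    then have "0 < (\<Prod>t<half_length k h. J (half_edge k h t) * \<epsilon> (J (half_edge k h t)))"
      using nz[OF h] by (intro prod_pos) auto
    then have "0 < half_product J k h * f h (half_length k h)"
      by (simp add: half_product_def f_def prod.distrib)
    moreover have "0 < \<tau> * half_product J k h"
      using up down h by auto
    ultimately show ?thesis
      by (auto simp: zero_less_mult_iff)
  qed
  define s where "s v = (if v \<in> C n k
      then f (if 0 \<le> snd v then int n else - int n) (half_index n k v) else undefined)" for v
  have s_path: "s (half_boundary k h t) = f h t"
    if h: "h = int n \<or> h = - int n" and t: "t \<le> half_length k h" for h t
  proof -
    have h': "\<bar>h\<bar> = int n"
      using h by auto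
    have "half_boundary k h t \<in> C n k"
      using h t k n by (auto simp: half_boundary_def half_length_def)
    moreover have "half_index n k (half_boundary k h t) = t"
      by (rule half_index_half_boundary[OF k n h' t])
    moreover have "f (if 0 \<le> snd (half_boundary k h t) then int n else - int n) t = f h t"
    proof (cases "t = 0 \<or> t = half_length k h")
      case True
      \<comment> \<open>At the two common ends of the halves both prescriptions give the same spin.\<close>
      moreover have "f (int n) (half_length k h) = f (- int n) (half_length k h)"
        using f_end[of "int n"] f_end[of "- int n"] f[of "int n" "half_length k h"]
          f[of "- int n" "half_length k h"] h
        by (auto simp: half_length_def)
      ultimately show ?thesis
        using h by (auto simp: f_def)
    next
      case False
      then show ?thesis
        using h t n by (auto simp: half_boundary_def half_length_def)
    qed
    ultimately show ?thesis
      by (simp add: s_def)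
  qed
  have "s \<in> states (C n k)"
    using f by (auto simp: states_def s_def PiE_iff extensional_def)
  moreover have "satisfied J s a" if a: "a \<in> boundary_edges n k" for a
  proof -
    obtain h t where ht: "\<bar>h\<bar> = int n" "t < half_length k h" "a = half_edge k h t"
      using boundary_edge_cases[OF k n a] .
    have h: "h = int n \<or> h = - int n"
      using ht(1) by auto
    have "spin_product s a = f h t * f h (Suc t)"
      using ht half_boundary_Suc_neq[OF ht(2)]
      by (simp add: half_edge_def spin_product_pair s_path[OF h])
    also have "\<dots> = \<epsilon> (J a)"
      using f[of h t] by (auto simp: f_def ht(3))
    finally show ?thesis
      using nz[OF h ht(2)] ht(3) by (auto simp: satisfied_def \<epsilon>_def)
  qed
  ultimately show ?thesis
    by blast
qed

lemma finite_boundary_edges [simp]: "finite (boundary_edges n k)"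
  by (rule finite_subset[OF _ finite_induced_edges_C[of n k]]) (auto simp: boundary_edges_def)

lemma c_admissible_iff:
  assumes "t \<in> states (C n k)" "\<forall>a\<in>boundary_edges n k. satisfied J t a"
  shows "c_admissible J n k s \<longleftrightarrow>
    s \<in> states (C n k) \<and> (\<forall>a\<in>boundary_edges n k. satisfied J s a)"
proof -
  let ?sat = "\<lambda>s. {a \<in> boundary_edges n k. satisfied J s a}"
  have le: "card (?sat s) \<le> card (boundary_edges n k)" for s
    by (intro card_mono) auto
  have t: "?sat t = boundary_edges n k"
    using assms(2) by auto
  have full: "?sat s = boundary_edges n k" if "\<not> card (?sat s) < card (boundary_edges n k)"
    by (rule card_subset_eq) (use le[of s] that in auto)
  show ?thesis
  proof
    assume "c_admissible J n k s"
    then have "s \<in> states (C n k)" "\<not> card (?sat s) < card (?sat t)"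
      using assms(1) by (auto simp: c_admissible_def is_arg_max_def)
    then show "s \<in> states (C n k) \<and> (\<forall>a\<in>boundary_edges n k. satisfied J s a)"
      using full unfolding t by blast
  next
    assume s: "s \<in> states (C n k) \<and> (\<forall>a\<in>boundary_edges n k. satisfied J s a)"
    then have "?sat s = boundary_edges n k"
      by auto
    then show "c_admissible J n k s"
      using s le by (auto simp: c_admissible_def is_arg_max_def not_less)
  qed
qed

section \<open>The window\<close>

text \<open>The limiting couplings in units of the standard deviation: a ferromagnet that is strong except on
  the edges that cross the centre column. Those are summable, so that the total energy of a wall
  along this column stays below the cost of a single strong edge, whatever its length.\<close>

definition base_coupling :: coupling where
  "base_coupling a = (if a \<in> range (hedge 0) then (1 / 2) ^ nat \<bar>inv (hedge 0) a\<bar> else 4)"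

text \<open>The window is the rectangle \<open>C (k - 1) k\<close>, which reaches the left and the right side of
  \<open>C n k\<close> but no row of height \<open>k\<close> or more. Its edges include the vertical ones to the rows at
  height \<open>\<plusminus>k\<close>; these get couplings near \<open>0\<close>, which cuts the window off from the uncontrolled
  couplings above and below it.\<close>

definition window_edges :: "nat \<Rightarrow> edge set" where
  "window_edges k = {a \<in> induced_edges (C k k). a \<inter> C (k - 1) k \<noteq> {}}"

definition window_low :: "nat \<Rightarrow> coupling" where
  "window_low k a = (if a \<subseteq> C (k - 1) k then base_coupling a else 0)"

text \<open>The \<open>6 * k + 1\<close> edges with small prescribed couplings together contribute less than \<open>1\<close>
  to the error made by allowing couplings to vary within this width.\<close>

definition window_width :: "nat \<Rightarrow> real" where
  "window_width k = 1 / (8 * real k + 8)"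

definition prescribed :: "real \<Rightarrow> nat \<Rightarrow> coupling \<Rightarrow> bool" where
  "prescribed \<sigma> k J \<longleftrightarrow>
     (\<forall>a\<in>window_edges k. J a \<in> {\<sigma> * window_low k a..\<sigma> * (window_low k a + window_width k)})"

lemma base_coupling_centre: "base_coupling (hedge 0 j) = (1 / 2) ^ nat \<bar>j\<bar>"
proof -
  have "inj (hedge 0)"
    by (auto simp: inj_def)
  then show ?thesis
    by (simp add: base_coupling_def)
qed

lemma base_coupling_strong:
  "i \<noteq> 0 \<Longrightarrow> base_coupling (hedge i j) = 4" "base_coupling (vedge i j) = 4"
  by (auto simp: base_coupling_def image_iff)

lemma base_coupling_bounds: "0 < base_coupling a" "base_coupling a \<le> 4"
proof -
  have "(1 / 2 :: real) ^ m \<le> 1" for m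
    by (rule power_le_one) auto
  then have "(1 / 2 :: real) ^ m \<le> 4" for m
    by (rule order_trans) simp
  then show "0 < base_coupling a" "base_coupling a \<le> 4"
    by (simp_all add: base_coupling_def)
qed

lemma sum_centre_couplings:
  assumes "0 < k"
  shows "(\<Sum>j\<in>{- int k<..<int k}. (1 / 2 :: real) ^ nat \<bar>j\<bar>) \<le> 3"
proof -
  have "(\<Sum>j\<in>{- int k<..<int k}. (1 / 2 :: real) ^ nat \<bar>j\<bar>) = 3 - 4 / 2 ^ k"
    using assms
  proof (induction k rule: nat_induct_non_zero)
    case 1
    have "{- int 1<..<int 1} = {0}"
      by auto
    then show ?case
      by simp
  next
    case (Suc k)
    have "{- int (Suc k)<..<int (Suc k)} = insert (int k) (insert (- int k) {- int k<..<int k})"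
      by auto
    then show ?case
      using Suc by (simp add: power_one_over)
  qed
  then show ?thesis
    by simp
qed

lemma hedge_window:
  assumes "- int k \<le> i" "i < int k" "\<bar>j\<bar> < int k"
  shows "hedge i j \<in> window_edges k" "window_low k (hedge i j) = base_coupling (hedge i j)"
proof -
  have "(i, j) \<in> C (k - 1) k" "(i + 1, j) \<in> C (k - 1) k"
    "(i, j) \<in> C k k" "(i + 1, j) \<in> C k k"
    using assms by auto
  then show "hedge i j \<in> window_edges k" "window_low k (hedge i j) = base_coupling (hedge i j)"
    unfolding window_edges_def window_low_def mem_Collect_eq induced_hedge_iff
    by (auto simp: hedge_def)
qed

lemma vedge_window:
  assumes "\<bar>i\<bar> \<le> int k" "- int k \<le> j" "j < int k"
  shows "vedge i j \<in> window_edges k"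
    and "window_low k (vedge i j) = (if - int k < j \<and> j < int k - 1 then 4 else 0)"
proof -
  have "(i, j) \<in> C (k - 1) k \<longleftrightarrow> - int k < j" "(i, j + 1) \<in> C (k - 1) k \<longleftrightarrow> j < int k - 1"
    using assms by auto
  then have sub: "vedge i j \<subseteq> C (k - 1) k \<longleftrightarrow> - int k < j \<and> j < int k - 1"
    and meet: "vedge i j \<inter> C (k - 1) k \<noteq> {} \<longleftrightarrow> - int k < j \<or> j < int k - 1"
    unfolding vedge_def by blast+
  show "vedge i j \<in> window_edges k"
    using assms unfolding window_edges_def mem_Collect_eq meet induced_vedge_iff C_iff by presburger
  show "window_low k (vedge i j) = (if - int k < j \<and> j < int k - 1 then 4 else 0)"
    unfolding window_low_def sub by (simp add: base_coupling_strong)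
qed

text \<open>The edges that a state which is constant on both halves of the window may leave unsatisfied: those
  crossing the centre column and those leaving the window.\<close>

definition loose_edges :: "nat \<Rightarrow> edge set" where
  "loose_edges k = hedge 0 ` {- int k<..<int k} \<union> (\<lambda>i. vedge i (int k - 1)) ` {- int k..int k} \<union>
     (\<lambda>i. vedge i (- int k)) ` {- int k..int k}"

text \<open>Reversing the product on every loose edge costs at most \<open>2 * \<sigma> * 4\<close>, which is what satisfying one
  strong edge gains.\<close>

lemma sum_loose_couplings:
  assumes k: "0 < k"
  shows "(\<Sum>a\<in>loose_edges k. window_low k a + window_width k) < 4"
proof -
  define L0 where "L0 = hedge 0 ` {- int k<..<int k}"
  define L1 where "L1 = (\<lambda>i. vedge i (int k - 1)) ` {- int k..int k}"
  define L2 where "L2 = (\<lambda>i. vedge i (- int k)) ` {- int k..int k}"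
  let ?U = "\<lambda>a. window_low k a + window_width k"
  have "(\<Sum>a\<in>L0. ?U a) = (\<Sum>j\<in>{- int k<..<int k}. ?U (hedge 0 j))"
    unfolding L0_def by (subst sum.reindex) (auto simp: inj_on_def)
  also have "\<dots> = (\<Sum>j\<in>{- int k<..<int k}. (1 / 2) ^ nat \<bar>j\<bar> + window_width k)"
    by (intro sum.cong) (use k in \<open>auto simp: hedge_window base_coupling_centre\<close>)
  also have "\<dots> = (\<Sum>j\<in>{- int k<..<int k}. (1 / 2) ^ nat \<bar>j\<bar>) + (2 * real k - 1) * window_width k"
    using k by (simp add: sum.distrib)
  also have "\<dots> \<le> 3 + (2 * real k - 1) * window_width k"
    using sum_centre_couplings[OF k] by simp
  finally have L0: "(\<Sum>a\<in>L0. ?U a) \<le> 3 + (2 * real k - 1) * window_width k" .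
  have "(\<Sum>a\<in>L1. ?U a) = (\<Sum>i\<in>{- int k..int k}. ?U (vedge i (int k - 1)))"
    unfolding L1_def by (subst sum.reindex) (auto simp: inj_on_def)
  also have "\<dots> = (\<Sum>i\<in>{- int k..int k}. window_width k)"
    by (intro sum.cong) (use k in \<open>auto simp: vedge_window\<close>)
  finally have L1: "(\<Sum>a\<in>L1. ?U a) = (2 * real k + 1) * window_width k"
    by simp
  have "(\<Sum>a\<in>L2. ?U a) = (\<Sum>i\<in>{- int k..int k}. ?U (vedge i (- int k)))"
    unfolding L2_def by (subst sum.reindex) (auto simp: inj_on_def)
  also have "\<dots> = (\<Sum>i\<in>{- int k..int k}. window_width k)"
    by (intro sum.cong) (use k in \<open>auto simp: vedge_window\<close>)
  finally have L2: "(\<Sum>a\<in>L2. ?U a) = (2 * real k + 1) * window_width k"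
    by simp
  have "int k - 1 \<noteq> - int k"
    using k by presburger
  then have "L0 \<inter> L1 = {}" "(L0 \<union> L1) \<inter> L2 = {}" "finite L0" "finite L1" "finite L2"
    by (auto simp: L0_def L1_def L2_def)
  then have "(\<Sum>a\<in>loose_edges k. ?U a) = (\<Sum>a\<in>L0. ?U a) + (\<Sum>a\<in>L1. ?U a) + (\<Sum>a\<in>L2. ?U a)"
    unfolding loose_edges_def L0_def[symmetric] L1_def[symmetric] L2_def[symmetric]
    by (simp add: sum.union_disjoint)
  also have "\<dots> \<le> 3 + (6 * real k + 1) * window_width k"
    using L0 unfolding L1 L2 by (simp add: algebra_simps)
  also have "(6 * real k + 1) * window_width k < 1"
    by (simp add: window_width_def divide_simps)
  finally show ?thesis
    by simp
qed

lemma loose_edges_window: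
  assumes "0 < k"
  shows "loose_edges k \<subseteq> window_edges k"
  using assms by (auto simp: loose_edges_def intro!: hedge_window(1) vedge_window(1))

lemma constant_on_interval:
  fixes f :: "int \<Rightarrow> 'a"
  assumes "\<And>j. a \<le> j \<Longrightarrow> j < b \<Longrightarrow> f j = f (j + 1)" "a \<le> j" "j \<le> b"
  shows "f j = f a"
  using assms(2,3) by (induction j rule: int_ge_induct) (use assms(1) in force)+

text \<open>Fixing the spins on the two sides fixes the groundstate on the window. Let \<open>t\<close> be the state that
  copies the left side to the left half of the window and the right side to the right half. If the
  groundstate \<open>s\<close> differed from \<open>t\<close> somewhere, then a row would contain an unsatisfied strong edge.
  Passing from \<open>s\<close> to \<open>t\<close> gains at least \<open>8 * \<sigma>\<close> there and loses less than \<open>8 * \<sigma>\<close>, since only loose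
  edges can lose. The boundary is not affected, so \<open>t\<close> is a competitor of \<open>s\<close>.\<close>

lemma groundstate_on_window:
  assumes k: "0 < k" and kn: "k \<le> n" and \<sigma>: "0 < \<sigma>"
    and J: "prescribed \<sigma> k J"
    and up: "0 < \<tau> * half_product J k (int n)" and down: "0 < \<tau> * half_product J k (- int n)"
    and \<tau>: "\<tau> = 1 \<or> \<tau> = -1"
    and s: "c_groundstate J n k s"
  shows "\<exists>s0. (s0 = 1 \<or> s0 = -1) \<and>
    (\<forall>i j. \<bar>i\<bar> \<le> int k \<longrightarrow> \<bar>j\<bar> < int k \<longrightarrow> s (i, j) = (if i \<le> 0 then s0 else \<tau> * s0))"
proof -
  let ?R = "C (k - 1) k" and ?E = "induced_edges (C n k)"
  have n: "0 < n"
    using k kn by simp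
  have R: "(i, j) \<in> ?R \<longleftrightarrow> \<bar>i\<bar> \<le> int k \<and> \<bar>j\<bar> < int k" for i j
    using k by auto
  obtain full where full: "full \<in> states (C n k)" "\<forall>a\<in>boundary_edges n k. satisfied J full a"
    using boundary_satisfiable[OF k n up down] by blast
  note admissible = c_admissible_iff[OF full]
  have s_states: "s \<in> states (C n k)" and s_sat: "\<forall>a\<in>boundary_edges n k. satisfied J s a"
    using s unfolding c_groundstate_def is_arg_min_def admissible by blast+
  have s_val: "\<forall>v\<in>C n k. s v = 1 \<or> s v = -1"
    using states_values[OF s_states] by blast
  have s_val': "s (i, j) = 1 \<or> s (i, j) = -1" if "\<bar>i\<bar> \<le> int k" "\<bar>j\<bar> \<le> int n" for i j
    using s_val that by auto
  have J_window: "\<sigma> * window_low k a \<le> J a" "J a \<le> \<sigma> * (window_low k a + window_width k)"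
    if "a \<in> window_edges k" for a
    using J that by (auto simp: prescribed_def)
  define s0 s1 where "s0 = s (- int k, 0)" and "s1 = s (int k, 0)"
  have s01: "s0 = 1 \<or> s0 = -1" "s1 = 1 \<or> s1 = -1"
    unfolding s0_def s1_def by (intro s_val'; simp)+
  have "0 < half_product J k (int n) * (s0 * s1)"
    using half_product_spins_pos[OF s_val _ s_sat, of "int n"] by (simp add: s0_def s1_def)
  then have s1_eq: "s1 = \<tau> * s0"
    using up s01 \<tau> by (auto simp: zero_less_mult_iff)

  \<comment> \<open>The vertical edges of the window in the two outer columns are satisfied and ferromagnetic.\<close>
  have column: "s (c, j) = s (c, 0)" if c: "\<bar>c\<bar> = int k" and j: "\<bar>j\<bar> < int k" for c j
  proof -
    have step: "s (c, i) = s (c, i + 1)" if i: "1 - int k \<le> i" "i < int k - 1" for i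
    proof -
      have "vedge c i \<in> boundary_edges n k"
        using c i kn by (auto simp: boundary_edges_def) (auto simp: vedge_def)
      then have "0 < J (vedge c i) * (s (c, i) * s (c, i + 1))"
        using s_sat by (auto simp: satisfied_def)
      moreover have "0 < J (vedge c i)"
      proof -
        have "\<sigma> * 4 \<le> J (vedge c i)"
          using J_window(1)[OF vedge_window(1)[of c k i]] vedge_window(2)[of c k i] c i by simp
        then show ?thesis
          using \<sigma> by linarith
      qed
      ultimately show ?thesis
        using s_val'[of c i] s_val'[of c "i + 1"] c i kn by (auto simp: zero_less_mult_iff)
    qed
    have "s (c, i) = s (c, 1 - int k)" if "\<bar>i\<bar> < int k" for i
    proof (rule constant_on_interval[where f = "\<lambda>j. s (c, j)" and b = "int k - 1"])
      show "s (c, j) = s (c, j + 1)" if "1 - int k \<le> j" "j < int k - 1" for j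
        by (rule step[OF that])
    qed (use that in auto)
    from this[OF j] this[of 0] show ?thesis
      using k by (metis abs_zero of_nat_0_less_iff)
  qed

  define t where "t v = (if v \<in> ?R then (if fst v \<le> 0 then s0 else s1) else s v)" for v
  have t_in: "t (i, j) = (if i \<le> 0 then s0 else s1)" if "\<bar>i\<bar> \<le> int k" "\<bar>j\<bar> < int k" for i j
    using that unfolding t_def R by simp
  have t_out: "t (i, j) = s (i, j)" if "\<not> \<bar>j\<bar> < int k" for i j
    using that unfolding t_def R by simp
  have t_states: "t \<in> states (C n k)"
    using s_states s01 k kn unfolding states_def t_def
    by (auto simp: PiE_iff extensional_def)
  \<comment> \<open>A boundary vertex in the window lies on the left or the right side, whose spins \<open>t\<close> retains.\<close>
  have t_boundary: "spin_product t a = spin_product s a" if "a \<in> boundary_edges n k" for a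
    unfolding spin_product_def
  proof (rule prod.cong)
    fix v
    assume "v \<in> a"
    obtain x y where v: "v = (x, y)"
      by fastforce
    have xy: "\<bar>x\<bar> = int k \<or> \<bar>y\<bar> = int n" "\<bar>x\<bar> \<le> int k"
      using that \<open>v \<in> a\<close> by (auto simp: boundary_edges_def induced_edges_def v)
    show "t v = s v"
    proof (cases "\<bar>y\<bar> < int k")
      case True
      then have x: "\<bar>x\<bar> = int k"
        using xy kn by auto
      then consider "x = - int k" | "x = int k"
        by linarith
      then have "s (x, 0) = (if x \<le> 0 then s0 else s1)"
        by cases (use k in \<open>simp_all add: s0_def s1_def\<close>)
      then show ?thesis
        using t_in[OF xy(2) True] column[OF x True] by (simp add: v)
    qed (simp add: v t_out)
  qed simp
  have "c_admissible J n k t"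
    unfolding admissible using t_states s_sat t_boundary by (auto simp: satisfied_def)
  then have "energy J ?E s \<le> energy J ?E t"
    using s by (auto simp: c_groundstate_def is_arg_min_def not_less)
  \<comment> \<open>The energy gained on the edge \<open>a\<close> by passing from \<open>s\<close> to \<open>t\<close>.\<close>
  define \<Delta> where "\<Delta> a = J a * (spin_product t a - spin_product s a)" for a
  have gain_le: "(\<Sum>a\<in>?E. \<Delta> a) \<le> 0"
    using \<open>energy J ?E s \<le> energy J ?E t\<close>
    by (simp add: energy_def \<Delta>_def algebra_simps sum_subtractf)

  let ?L = "loose_edges k"
  have window_E: "window_edges k \<subseteq> ?E"
    using kn by (auto simp: window_edges_def induced_edges_def)
  have L_window: "?L \<subseteq> window_edges k"
    by (rule loose_edges_window[OF k])
  have sp_val: "spin_product x a = 1 \<or> spin_product x a = -1"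
    if "a \<in> ?E" "x \<in> states (C n k)" for a x
  proof -
    have a: "a \<in> lattice_edges" "a \<subseteq> C n k"
      using that(1) by (auto simp: induced_edges_def)
    note x = states_values[OF that(2)]
    from a(1) show ?thesis
    proof (cases rule: lattice_edges_cases)
      case (1 i j)
      then show ?thesis
        using a(2) x[of "(i, j)"] x[of "(i + 1, j)"] by (auto simp: hedge_def spin_product_pair)
    next
      case (2 i j)
      then show ?thesis
        using a(2) x[of "(i, j)"] x[of "(i, j + 1)"] by (auto simp: vedge_def spin_product_pair)
    qed
  qed
  have low_nonneg: "0 \<le> window_low k a" for a
    using base_coupling_bounds(1)[of a] by (simp add: window_low_def)
  have J_nonneg: "0 \<le> J a" if "a \<in> window_edges k" for a
    using J_window(1)[OF that] low_nonneg[of a] \<sigma> by (meson mult_nonneg_nonneg less_imp_le order_trans)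
  have loss: "- 2 * \<sigma> * (window_low k a + window_width k) \<le> \<Delta> a" if "a \<in> window_edges k" for a
  proof -
    have aE: "a \<in> ?E"
      using that window_E by blast
    have "- 2 * J a \<le> \<Delta> a"
      using sp_val[OF aE s_states] sp_val[OF aE t_states] J_nonneg[OF that]
      by (auto simp: \<Delta>_def)
    then show ?thesis
      using J_window(2)[OF that] by linarith
  qed
  have gain: "0 \<le> \<Delta> a" if a: "a \<in> ?E - ?L" for a
  proof -
    have aE: "a \<in> ?E" and aL: "a \<notin> ?L"
      using a by auto
    have agree: ?thesis if "spin_product t a = 1" "a \<in> window_edges k"
      using sp_val[OF aE s_states] J_nonneg[OF that(2)] that(1) by (auto simp: \<Delta>_def)
    have "a \<in> lattice_edges" "a \<subseteq> C n k"
      using aE by (auto simp: induced_edges_def)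
    then show ?thesis
    proof (cases rule: lattice_edges_cases)
      case (1 i j)
      have i: "- int k \<le> i" "i < int k"
        using \<open>a \<subseteq> C n k\<close> by (auto simp: 1 hedge_def)
      show ?thesis
      proof (cases "\<bar>j\<bar> < int k")
        case True
        then have "i \<noteq> 0"
          using aL by (auto simp: 1 loose_edges_def image_iff)
        then have "t (i, j) = t (i + 1, j)"
          using i True by (simp add: t_in)
        then have "spin_product t a = 1"
          using i True s01 by (auto simp: 1 t_in)
        then show ?thesis
          using agree hedge_window(1)[OF i True] by (simp add: 1)
      next
        case False
        then show ?thesis
          by (simp add: \<Delta>_def 1 t_out)
      qed
    next
      case (2 i j)
      have i: "\<bar>i\<bar> \<le> int k"
        using \<open>a \<subseteq> C n k\<close> by (auto simp: 2 vedge_def)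
      have j: "j \<noteq> int k - 1" "j \<noteq> - int k"
        using aL i by (auto simp: 2 loose_edges_def image_iff)
      show ?thesis
      proof (cases "\<bar>j\<bar> < int k")
        case True
        then have "\<bar>j + 1\<bar> < int k"
          using j by auto
        then have "spin_product t a = 1"
          using i True s01 by (auto simp: 2 t_in)
        then show ?thesis
          using agree vedge_window(1)[of i k j] i True by (simp add: 2)
      next
        case False
        then have "\<not> \<bar>j + 1\<bar> < int k"
          using j by auto
        then show ?thesis
          using False by (simp add: \<Delta>_def 2 t_out)
      qed
    qed
  qed

  have "s (i, j) = t (i, j)" if i: "\<bar>i\<bar> \<le> int k" and j: "\<bar>j\<bar> < int k" for i j
  proof (rule ccontr)
    assume bad: "s (i, j) \<noteq> t (i, j)"
    have ends: "s (- int k, j) = s0" "s (int k, j) = s1"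
      using column[of "- int k" j] column[of "int k" j] j by (simp_all add: s0_def s1_def)
    \<comment> \<open>Between \<open>i\<close> and the side on its half of the window the row has to change its spin.\<close>
    obtain r where r: "- int k \<le> r" "r < int k" "r \<noteq> 0" "s (r, j) \<noteq> s (r + 1, j)"
    proof (cases "i \<le> 0")
      case True
      have "\<exists>r. - int k \<le> r \<and> r < i \<and> s (r, j) \<noteq> s (r + 1, j)"
      proof (rule ccontr)
        assume "\<not> ?thesis"
        then have "s (r, j) = s (r + 1, j)" if "- int k \<le> r" "r < i" for r
          using that by blast
        then have "s (i, j) = s (- int k, j)"
          by (rule constant_on_interval[where f = "\<lambda>r. s (r, j)"]) (use i in auto)
        then show False
          using bad ends True t_in[OF i j] by simp
      qed
      then obtain r where "- int k \<le> r" "r < i" "s (r, j) \<noteq> s (r + 1, j)"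
        by blast
      then show thesis
        using True i by (intro that[of r]) auto
    next
      case False
      have "\<exists>r. i \<le> r \<and> r < int k \<and> s (r, j) \<noteq> s (r + 1, j)"
      proof (rule ccontr)
        assume "\<not> ?thesis"
        then have "s (r, j) = s (r + 1, j)" if "i \<le> r" "r < int k" for r
          using that by blast
        then have "s (int k, j) = s (i, j)"
          by (rule constant_on_interval[where f = "\<lambda>r. s (r, j)"]) (use i in auto)
        then show False
          using bad ends False t_in[OF i j] by simp
      qed
      then obtain r where "i \<le> r" "r < int k" "s (r, j) \<noteq> s (r + 1, j)"
        by blast
      then show thesis
        using False i by (intro that[of r]) auto
    qed
    let ?b = "hedge r j"
    have b: "?b \<in> window_edges k" "\<sigma> * 4 \<le> J ?b"
      using hedge_window[OF r(1,2) j] J_window(1)[of ?b] by (simp_all add: base_coupling_strong r(3))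
    have "s (r, j) * s (r + 1, j) = -1"
    proof -
      have "\<bar>r\<bar> \<le> int k" "\<bar>r + 1\<bar> \<le> int k" "\<bar>j\<bar> \<le> int n"
        using r j kn by auto
      then show ?thesis
        using r(4) s_val'[of r j] s_val'[of "r + 1" j] by auto
    qed
    moreover have "t (r, j) * t (r + 1, j) = 1"
      using r j s01 by (auto simp: t_in)
    ultimately have "\<Delta> ?b = 2 * J ?b"
      by (simp add: \<Delta>_def)
    then have b_gain: "8 * \<sigma> \<le> \<Delta> ?b"
      using b(2) by linarith
    have b_notin: "?b \<notin> ?L"
      using r(3) by (auto simp: loose_edges_def)
    have "(\<Sum>a\<in>?L. - 2 * \<sigma> * (window_low k a + window_width k)) =
        - 2 * \<sigma> * (\<Sum>a\<in>?L. window_low k a + window_width k)"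
      by (rule sum_distrib_left[symmetric])
    moreover have "2 * \<sigma> * (\<Sum>a\<in>?L. window_low k a + window_width k) < 2 * \<sigma> * 4"
      using sum_loose_couplings[OF k] \<sigma> by (intro mult_strict_left_mono) auto
    ultimately have "- 8 * \<sigma> < (\<Sum>a\<in>?L. - 2 * \<sigma> * (window_low k a + window_width k))"
      by linarith
    also have "\<dots> \<le> (\<Sum>a\<in>?L. \<Delta> a)"
      using loss L_window by (intro sum_mono) blast
    finally have "0 < \<Delta> ?b + (\<Sum>a\<in>?L. \<Delta> a)"
      using b_gain by linarith
    also have "\<dots> = (\<Sum>a\<in>insert ?b ?L. \<Delta> a)"
      using b_notin finite_subset[OF L_window finite_subset[OF window_E]] by simp
    also have "\<dots> \<le> (\<Sum>a\<in>?E. \<Delta> a)"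
      using gain b(1) L_window window_E by (intro sum_mono2) auto
    finally show False
      using gain_le by simp
  qed
  then have "\<forall>i j. \<bar>i\<bar> \<le> int k \<longrightarrow> \<bar>j\<bar> < int k \<longrightarrow> s (i, j) = (if i \<le> 0 then s0 else \<tau> * s0)"
    by (simp add: t_in s1_eq)
  then show ?thesis
    using s01(1) by blast
qed

section \<open>Probability of a good assignment\<close>

abbreviation gaussian :: "real \<Rightarrow> real measure" where
  "gaussian \<sigma> \<equiv> density lborel (\<lambda>x. ennreal (normal_density 0 \<sigma> x))"

lemma emeasure_gaussian_uminus:
  assumes "A \<in> sets borel"
  shows "emeasure (gaussian \<sigma>) (uminus -` A) = emeasure (gaussian \<sigma>) A"
proof -
  have [measurable]: "A \<in> sets borel" "uminus -` A \<in> sets borel"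
    using assms measurable_sets[of uminus borel borel A] by auto
  have "emeasure (gaussian \<sigma>) A = (\<integral>\<^sup>+ x. ennreal (normal_density 0 \<sigma> x) * indicator A x \<partial>lborel)"
    by (simp add: emeasure_density)
  also have "\<dots> = (\<integral>\<^sup>+ x. ennreal (normal_density 0 \<sigma> (- x)) * indicator A (- x) \<partial>lborel)"
    using nn_integral_real_affine[of "\<lambda>x. ennreal (normal_density 0 \<sigma> x) * indicator A x" "-1" 0]
    by simp
  also have "\<dots> = emeasure (gaussian \<sigma>) (uminus -` A)"
    by (simp add: emeasure_density normal_density_def indicator_def)
  finally show ?thesis ..
qed

definition density_bound :: real where
  "density_bound = exp (- 25 / 2) / sqrt (2 * pi)"

text \<open>The intervals scale with the standard deviation, hence the bound does not depend on it: the
  density at \<open>\<sigma> * y\<close> with \<open>0 \<le> y \<le> 5\<close> is at least \<open>density_bound / \<sigma>\<close>.\<close>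

lemma gaussian_interval_ge:
  assumes \<sigma>: "0 < \<sigma>" and x: "0 \<le> x" "0 \<le> w" "x + w \<le> 5"
  shows "ennreal (density_bound * w) \<le> emeasure (gaussian \<sigma>) {\<sigma> * x..\<sigma> * (x + w)}"
proof -
  have bound: "density_bound / \<sigma> \<le> normal_density 0 \<sigma> y"
    if "\<sigma> * x \<le> y" "y \<le> \<sigma> * (x + w)" for y
  proof -
    have "0 \<le> y" "y \<le> \<sigma> * 5"
      using that x \<sigma> by (meson mult_nonneg_nonneg less_imp_le mult_left_mono order_trans)+
    then have "y\<^sup>2 \<le> (\<sigma> * 5)\<^sup>2"
      by (intro power_mono) auto
    then have "- 25 / 2 \<le> - (y\<^sup>2 / (2 * \<sigma>\<^sup>2))"
      using \<sigma> by (simp add: divide_simps power2_eq_square)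
    then have "exp (- 25 / 2) \<le> exp (- (y\<^sup>2 / (2 * \<sigma>\<^sup>2)))"
      by (simp only: exp_le_cancel_iff)
    then show ?thesis
      using \<sigma> by (simp add: density_bound_def normal_density_def real_sqrt_mult divide_simps mult_ac)
  qed
  have "ennreal (density_bound * w) =
      ennreal (density_bound / \<sigma>) * emeasure lborel {\<sigma> * x..\<sigma> * (x + w)}"
    using \<sigma> x by (simp add: distrib_left density_bound_def flip: ennreal_mult)
  also have "\<dots> = (\<integral>\<^sup>+ y. ennreal (density_bound / \<sigma>) * indicator {\<sigma> * x..\<sigma> * (x + w)} y \<partial>lborel)"
    by (simp add: nn_integral_cmult_indicator)
  also have "\<dots> \<le> (\<integral>\<^sup>+ y. ennreal (normal_density 0 \<sigma> y) * indicator {\<sigma> * x..\<sigma> * (x + w)} y \<partial>lborel)"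
    using bound by (intro nn_integral_mono) (auto simp: indicator_def intro: ennreal_leI)
  also have "\<dots> = emeasure (gaussian \<sigma>) {\<sigma> * x..\<sigma> * (x + w)}"
    by (simp add: emeasure_density)
  finally show ?thesis .
qed

definition flip_signs :: "edge set \<Rightarrow> edge set \<Rightarrow> coupling \<Rightarrow> coupling" where
  "flip_signs E D J = (\<lambda>a\<in>E. if a \<in> D then - J a else J a)"

lemma flip_signs_measurable:
  "flip_signs E D \<in> (\<Pi>\<^sub>M a\<in>E. gaussian \<sigma>) \<rightarrow>\<^sub>M (\<Pi>\<^sub>M a\<in>E. gaussian \<sigma>)"
proof -
  have [measurable]: "(\<lambda>J. J a) \<in> borel_measurable (\<Pi>\<^sub>M a\<in>E. gaussian \<sigma>)" if "a \<in> E" for a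
    using measurable_component_singleton[OF that, of "\<lambda>_. gaussian \<sigma>"] by simp
  show ?thesis
    unfolding flip_signs_def
    by (intro measurable_restrict) (auto intro!: borel_measurable_uminus)
qed

text \<open>A centred Gaussian is symmetric, so reversing the signs of any fixed set of independent couplings
  preserves their joint law.\<close>

lemma distr_flip_signs:
  assumes \<sigma>: "0 < \<sigma>" and E: "finite E"
  shows "distr (\<Pi>\<^sub>M a\<in>E. gaussian \<sigma>) (\<Pi>\<^sub>M a\<in>E. gaussian \<sigma>) (flip_signs E D) = (\<Pi>\<^sub>M a\<in>E. gaussian \<sigma>)"
proof -
  interpret prob_space "gaussian \<sigma>"
    by (rule prob_space_normal_density[OF \<sigma>])
  interpret product_sigma_finite "\<lambda>_::edge. gaussian \<sigma>"
    by standard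
  show ?thesis
  proof (rule PiM_eqI)
    fix A :: "edge \<Rightarrow> real set"
    assume A: "\<And>a. a \<in> E \<Longrightarrow> A a \<in> sets (gaussian \<sigma>)"
    define B where "B a = (if a \<in> D then uminus -` A a else A a)" for a
    have B: "B a \<in> sets (gaussian \<sigma>)" if "a \<in> E" for a
      using A[OF that] measurable_sets[of uminus borel borel "A a"] by (auto simp: B_def)
    have "flip_signs E D -` Pi\<^sub>E E A \<inter> space (\<Pi>\<^sub>M a\<in>E. gaussian \<sigma>) = Pi\<^sub>E E B"
      by (auto simp: flip_signs_def B_def space_PiM PiE_iff extensional_def split: if_splits)
    then have "emeasure (distr (\<Pi>\<^sub>M a\<in>E. gaussian \<sigma>) (\<Pi>\<^sub>M a\<in>E. gaussian \<sigma>) (flip_signs E D)) (Pi\<^sub>E E A)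
        = emeasure (\<Pi>\<^sub>M a\<in>E. gaussian \<sigma>) (Pi\<^sub>E E B)"
      using A E by (subst emeasure_distr) (auto intro!: flip_signs_measurable sets_PiM_I_finite)
    also have "\<dots> = (\<Prod>a\<in>E. emeasure (gaussian \<sigma>) (B a))"
      using B E by (intro emeasure_PiM) auto
    also have "\<dots> = (\<Prod>a\<in>E. emeasure (gaussian \<sigma>) (A a))"
      using A by (intro prod.cong) (auto simp: B_def emeasure_gaussian_uminus)
    finally show "emeasure (distr (\<Pi>\<^sub>M a\<in>E. gaussian \<sigma>) (\<Pi>\<^sub>M a\<in>E. gaussian \<sigma>) (flip_signs E D)) (Pi\<^sub>E E A)
        = (\<Prod>a\<in>E. emeasure (gaussian \<sigma>) (A a))" .
  qed (use E in auto)
qed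

text \<open>The signed heights of the four half boundaries of \<open>C l k\<close> and \<open>C (l - 1) k\<close>.\<close>

definition flip_heights :: "nat \<Rightarrow> int set" where
  "flip_heights l = {int l, - int l, int l - 1, 1 - int l}"

text \<open>The upper and the lower half product of each of the two rectangles have to agree for its boundary
  to be satisfiable. They have to be positive for \<open>C l k\<close> and negative for \<open>C (l - 1) k\<close> for the
  two rectangles to induce opposite relative signs of their sides.\<close>

definition required_sign :: "nat \<Rightarrow> int \<Rightarrow> real" where
  "required_sign l h = (if \<bar>h\<bar> = int l then 1 else -1)"

definition good :: "real \<Rightarrow> nat \<Rightarrow> nat \<Rightarrow> coupling \<Rightarrow> bool" where
  "good \<sigma> l k J \<longleftrightarrow> prescribed \<sigma> k J \<and>
     (\<forall>h\<in>flip_heights l. 0 < required_sign l h * half_product J k h)"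

lemma half_edge_induced:
  assumes "\<bar>h\<bar> \<le> int l" "t < half_length k h"
  shows "half_edge k h t \<in> induced_edges (C l k)"
proof -
  have "half_edge k h t \<in> induced_edges (C (nat \<bar>h\<bar>) k)"
    using half_edge_boundary[of h "nat \<bar>h\<bar>", OF _ assms(2)] by (simp add: boundary_edges_def)
  moreover have "C (nat \<bar>h\<bar>) k \<subseteq> C l k"
    using assms(1) by (auto simp: C_def)
  ultimately show ?thesis
    by (auto simp: induced_edges_def)
qed

text \<open>The four half products can be changed independently of each other by changing the signs of the
  couplings in the centre column at the respective heights.\<close>

lemma half_product_flip_signs:
  assumes "0 < k" "h \<noteq> 0" "\<bar>h\<bar> \<le> int l"
  shows "half_product (flip_signs (induced_edges (C l k)) (hedge 0 ` D) J) k h =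
    (if h \<in> D then - half_product J k h else half_product J k h)"
proof -
  define c where "c = (if h \<in> D then -1 else 1 :: real)"
  have "half_product (flip_signs (induced_edges (C l k)) (hedge 0 ` D) J) k h =
      (\<Prod>t<half_length k h. (if t = nat \<bar>h\<bar> + k then c else 1) * J (half_edge k h t))"
    unfolding half_product_def
  proof (rule prod.cong)
    fix t
    assume "t \<in> {..<half_length k h}"
    then have t: "t < half_length k h"
      by simp
    have "half_edge k h t \<in> hedge 0 ` D \<longleftrightarrow> t = nat \<bar>h\<bar> + k \<and> h \<in> D"
      using half_edge_eq_hedge_iff[OF t] assms(1) by (auto simp: image_iff)
    then show "flip_signs (induced_edges (C l k)) (hedge 0 ` D) J (half_edge k h t) =
        (if t = nat \<bar>h\<bar> + k then c else 1) * J (half_edge k h t)"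
      using half_edge_induced[OF assms(3) t] by (simp add: flip_signs_def c_def)
  qed simp
  also have "\<dots> = c * half_product J k h"
    using assms(2) by (simp add: prod.distrib half_product_def half_length_def)
  finally show ?thesis
    by (simp add: c_def)
qed

lemma finite_window_edges [simp]: "finite (window_edges k)"
  by (rule finite_subset[OF _ finite_induced_edges_C[of k k]]) (auto simp: window_edges_def)

lemma window_edges_subset: "k \<le> l \<Longrightarrow> window_edges k \<subseteq> induced_edges (C l k)"
  by (auto simp: window_edges_def induced_edges_def)

text \<open>The flipped edges lie at height at least \<open>k\<close>, outside the window.\<close>

lemma prescribed_flip_signs:
  assumes "0 < k" "k \<le> l" "\<forall>h\<in>D. int k \<le> \<bar>h\<bar>"
  shows "prescribed \<sigma> k (flip_signs (induced_edges (C l k)) (hedge 0 ` D) J) \<longleftrightarrow> prescribed \<sigma> k J"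
proof -
  have "hedge 0 h \<notin> window_edges k" if "h \<in> D" for h
  proof -
    have "\<not> \<bar>h\<bar> \<le> int (k - 1)"
      using assms(1,3) that by fastforce
    then show ?thesis
      by (auto simp: window_edges_def hedge_def)
  qed
  then have "flip_signs (induced_edges (C l k)) (hedge 0 ` D) J a = J a" if "a \<in> window_edges k" for a
    using that window_edges_subset[OF assms(2)] by (auto simp: flip_signs_def)
  then show ?thesis
    by (simp add: prescribed_def)
qed

lemma half_product_measurable [measurable]:
  assumes "\<bar>h\<bar> \<le> int l"
  shows "(\<lambda>J. half_product J k h) \<in> borel_measurable (gaussian_couplings \<sigma> l k)"
proof -
  have "(\<lambda>J. J (half_edge k h t)) \<in> borel_measurable (gaussian_couplings \<sigma> l k)"
    if "t < half_length k h" for t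
    using measurable_component_singleton[OF half_edge_induced[OF assms that], of "\<lambda>_. gaussian \<sigma>"]
    by (simp add: gaussian_couplings_def)
  then show ?thesis
    unfolding half_product_def by (intro borel_measurable_prod) auto
qed

lemma sets_prescribed:
  assumes "k \<le> l"
  shows "{J \<in> space (gaussian_couplings \<sigma> l k). prescribed \<sigma>' k J} \<in> sets (gaussian_couplings \<sigma> l k)"
proof -
  have [measurable]: "(\<lambda>J. J a) \<in> borel_measurable (gaussian_couplings \<sigma> l k)" if "a \<in> window_edges k" for a
    using measurable_component_singleton[of a "induced_edges (C l k)" "\<lambda>_. gaussian \<sigma>"]
      window_edges_subset[OF assms] that by (auto simp: gaussian_couplings_def)
  show ?thesis
    unfolding prescribed_def by (intro sets.sets_Collect_finite_All) (auto intro!: measurable_sets_Collect)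
qed

lemma sets_good:
  assumes "0 < l" "k \<le> l"
  shows "{J \<in> space (gaussian_couplings \<sigma> l k). good \<sigma>' l k J} \<in> sets (gaussian_couplings \<sigma> l k)"
proof -
  let ?G = "gaussian_couplings \<sigma> l k"
  have "{J \<in> space ?G. 0 < required_sign l h * half_product J k h} \<in> sets ?G" if "h \<in> flip_heights l" for h
  proof -
    have "\<bar>h\<bar> \<le> int l"
      using that assms(1) by (auto simp: flip_heights_def)
    note half_product_measurable[OF this, measurable]
    show ?thesis
      by measurable
  qed
  then have "{J \<in> space ?G. \<forall>h\<in>flip_heights l. 0 < required_sign l h * half_product J k h} \<in> sets ?G"
    by (intro sets.sets_Collect_finite_All) (auto simp: flip_heights_def)
  then show ?thesis
    unfolding good_def using sets_prescribed[OF assms(2)] by (intro sets.sets_Collect_conj)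
qed

lemma ennreal_prod_mono:
  fixes f g :: "'a \<Rightarrow> ennreal"
  assumes "\<And>a. a \<in> A \<Longrightarrow> f a \<le> g a"
  shows "prod f A \<le> prod g A"
  using assms by (induction A rule: infinite_finite_induct) (auto intro!: mult_mono)

lemma prescribed_prob:
  assumes \<sigma>: "0 < \<sigma>" and k: "k \<le> l"
  shows "ennreal ((density_bound * window_width k) ^ card (window_edges k)) \<le>
    emeasure (gaussian_couplings \<sigma> l k) {J \<in> space (gaussian_couplings \<sigma> l k). prescribed \<sigma> k J}"
proof -
  let ?E = "induced_edges (C l k)" and ?W = "window_edges k"
  interpret prob_space "gaussian \<sigma>"
    by (rule prob_space_normal_density[OF \<sigma>])
  interpret product_sigma_finite "\<lambda>_::edge. gaussian \<sigma>"
    by standard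
  define I where "I a = (if a \<in> ?W
    then {\<sigma> * window_low k a..\<sigma> * (window_low k a + window_width k)} else UNIV)" for a
  have sub: "?W \<subseteq> ?E"
    by (rule window_edges_subset[OF k])
  have "{J \<in> space (gaussian_couplings \<sigma> l k). prescribed \<sigma> k J} = Pi\<^sub>E ?E I"
  proof -
    have "(\<forall>a\<in>?W. J a \<in> {\<sigma> * window_low k a..\<sigma> * (window_low k a + window_width k)}) \<longleftrightarrow>
        (\<forall>a\<in>?E. J a \<in> I a)" for J
      using sub unfolding I_def by auto
    then show ?thesis
      by (auto simp: gaussian_couplings_def space_PiM PiE_def Pi_def prescribed_def)
  qed
  then have "emeasure (gaussian_couplings \<sigma> l k) {J \<in> space (gaussian_couplings \<sigma> l k). prescribed \<sigma> k J}
      = (\<Prod>a\<in>?E. emeasure (gaussian \<sigma>) (I a))"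
    unfolding gaussian_couplings_def by (simp add: emeasure_PiM I_def)
  also have "\<dots> = (\<Prod>a\<in>?W. emeasure (gaussian \<sigma>) (I a))"
    using sub emeasure_space_1 by (intro prod.mono_neutral_right) (auto simp: I_def)
  also have "\<dots> \<ge> (\<Prod>a\<in>?W. ennreal (density_bound * window_width k))"
  proof (rule ennreal_prod_mono)
    fix a
    assume a: "a \<in> ?W"
    have "0 \<le> window_low k a" "window_low k a \<le> 4"
      using base_coupling_bounds[of a] by (auto simp: window_low_def)
    moreover have "0 \<le> window_width k" "window_width k \<le> 1"
      by (auto simp: window_width_def divide_simps)
    ultimately show "ennreal (density_bound * window_width k) \<le> emeasure (gaussian \<sigma>) (I a)"
      using a gaussian_interval_ge[OF \<sigma>, of "window_low k a" "window_width k"] by (auto simp: I_def)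
  qed
  moreover have "0 \<le> density_bound * window_width k"
    by (simp add: density_bound_def window_width_def)
  ultimately show ?thesis
    by (simp add: ennreal_power)
qed

lemma AE_coupling_nonzero:
  assumes \<sigma>: "0 < \<sigma>" and "a \<in> induced_edges (C l k)"
  shows "AE J in gaussian_couplings \<sigma> l k. J a \<noteq> 0"
  unfolding gaussian_couplings_def
proof (rule AE_PiM_component)
  show "AE x in gaussian \<sigma>. x \<noteq> 0"
    using AE_lborel_singleton[of "0 :: real"] by (auto simp: AE_density elim: eventually_mono)
qed (use assms prob_space_normal_density in auto)

text \<open>The denominator counts the sets of heights at which signs may be flipped.\<close>

definition good_prob :: "nat \<Rightarrow> real" where
  "good_prob k = (density_bound * window_width k) ^ card (window_edges k) / 16"

text \<open>Independently of \<open>l\<close>, although the half products involve about \<open>4 * l\<close> couplings: almost every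
  assignment that is prescribed on the window becomes good after flipping one of the \<open>16\<close> sets of
  signs, and each of these flips preserves the law. So the preimages of the good event under the
  flips, which all have its probability, cover the event prescribed on the window.\<close>

lemma good_prob_le:
  assumes \<sigma>: "0 < \<sigma>" and k: "0 < k" "k < l"
  shows "ennreal (good_prob k) \<le>
    emeasure (gaussian_couplings \<sigma> l k) {J \<in> space (gaussian_couplings \<sigma> l k). good \<sigma> l k J}"
proof -
  let ?G = "gaussian_couplings \<sigma> l k" and ?E = "induced_edges (C l k)"
  define A where "A = {J \<in> space ?G. prescribed \<sigma> k J}"
  define B where "B = {J \<in> space ?G. good \<sigma> l k J}"
  let ?T = "\<lambda>D. flip_signs ?E (hedge 0 ` D)"
  have heights: "int k \<le> \<bar>h\<bar>" "\<bar>h\<bar> \<le> int l" "h \<noteq> 0" if "h \<in> flip_heights l" for h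
    using that k by (auto simp: flip_heights_def)
  have B_sets: "B \<in> sets ?G"
    unfolding B_def using k by (intro sets_good) auto
  have T: "?T D \<in> ?G \<rightarrow>\<^sub>M ?G" "distr ?G ?G (?T D) = ?G" for D
    unfolding gaussian_couplings_def using \<sigma> by (simp_all add: flip_signs_measurable distr_flip_signs)
  have T_sets: "?T D -` B \<inter> space ?G \<in> sets ?G" for D
    using T(1) B_sets by (rule measurable_sets)
  have T_prob: "emeasure ?G (?T D -` B \<inter> space ?G) = emeasure ?G B" for D
    using emeasure_distr[OF T(1) B_sets, of D] by (simp add: T(2))
  have fin: "finite (flip_heights l)"
    by (simp add: flip_heights_def)
  have "AE J in ?G. \<forall>a\<in>?E. J a \<noteq> 0"
    using \<sigma> by (intro AE_finite_allI) (auto intro: AE_coupling_nonzero)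
  moreover have "J \<in> (\<Union>D\<in>Pow (flip_heights l). ?T D -` B \<inter> space ?G)"
    if nz: "\<forall>a\<in>?E. J a \<noteq> 0" and J: "J \<in> A" for J
  proof -
    \<comment> \<open>Flip exactly where the half product has the wrong sign.\<close>
    define D where "D = {h \<in> flip_heights l. required_sign l h * half_product J k h < 0}"
    have space: "J \<in> space ?G" and presc: "prescribed \<sigma> k J"
      using J by (auto simp: A_def)
    have "?T D J \<in> space ?G"
      using measurable_space[OF T(1) space] .
    moreover have "prescribed \<sigma> k (?T D J)"
      using prescribed_flip_signs[of k l D \<sigma> J] heights k presc by (auto simp: D_def)
    moreover have "0 < required_sign l h * half_product (?T D J) k h" if h: "h \<in> flip_heights l" for h
    proof -
      have "half_product J k h \<noteq> 0"
        using nz half_edge_induced[OF heights(2)[OF h]] by (auto simp: half_product_def)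
      then have "required_sign l h * half_product J k h < 0 \<or> 0 < required_sign l h * half_product J k h"
        by (auto simp: required_sign_def)
      then show ?thesis
        using half_product_flip_signs[OF k(1) heights(3,2)[OF h], of D J] h
        by (cases "required_sign l h * half_product J k h < 0") (simp_all add: D_def)
    qed
    ultimately have "?T D J \<in> B"
      by (simp add: B_def good_def)
    moreover have "D \<in> Pow (flip_heights l)"
      by (auto simp: D_def)
    ultimately show ?thesis
      using space by blast
  qed
  ultimately have "AE J in ?G. J \<in> A \<longrightarrow> J \<in> (\<Union>D\<in>Pow (flip_heights l). ?T D -` B \<inter> space ?G)"
    by (auto elim!: eventually_mono)
  then have "emeasure ?G A \<le> emeasure ?G (\<Union>D\<in>Pow (flip_heights l). ?T D -` B \<inter> space ?G)"
    using fin T_sets by (intro emeasure_mono_AE sets.finite_UN) auto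
  also have "\<dots> \<le> (\<Sum>D\<in>Pow (flip_heights l). emeasure ?G (?T D -` B \<inter> space ?G))"
    using fin T_sets by (intro emeasure_subadditive_finite) auto
  also have "\<dots> = of_nat (card (Pow (flip_heights l))) * emeasure ?G B"
    by (simp add: T_prob)
  also have "\<dots> \<le> 16 * emeasure ?G B"
  proof -
    have "card (flip_heights l) \<le> 4"
      using card_length[of "[int l, - int l, int l - 1, 1 - int l]"] by (simp add: flip_heights_def)
    then have "(2::nat) ^ card (flip_heights l) \<le> 2 ^ 4"
      by (intro power_increasing) auto
    then have "of_nat (card (Pow (flip_heights l))) \<le> (of_nat 16 :: ennreal)"
      by (intro of_nat_mono) (simp add: card_Pow fin)
    then show ?thesis
      by (intro mult_right_mono) auto
  qed
  finally have "ennreal ((density_bound * window_width k) ^ card (window_edges k)) \<le> 16 * emeasure ?G B"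
    using prescribed_prob[OF \<sigma>, of k l] k by (auto simp: A_def)
  moreover have "0 \<le> (density_bound * window_width k) ^ card (window_edges k)"
    by (simp add: density_bound_def window_width_def)
  ultimately have "16 * ennreal (good_prob k) \<le> 16 * emeasure ?G B"
    using ennreal_mult[of 16 "good_prob k"] by (simp add: good_prob_def)
  then show ?thesis
    unfolding B_def by (subst (asm) ennreal_mult_le_mult_iff) auto
qed

lemma good_prob_bounds: "0 < good_prob k" "good_prob k < 1"
proof -
  have "exp (- 25 / 2) \<le> (1::real)"
    by simp
  moreover have "1 \<le> sqrt (2 * pi)"
    using pi_gt3 by (intro real_le_rsqrt) simp
  ultimately have "exp (- 25 / 2) \<le> sqrt (2 * pi)"
    by (rule order_trans)
  then have d: "0 < density_bound" "density_bound \<le> 1"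
    by (simp_all add: density_bound_def divide_simps)
  have w: "0 < window_width k" "window_width k \<le> 1"
    by (auto simp: window_width_def divide_simps)
  have "density_bound * window_width k \<le> 1"
    using d w by (intro mult_le_one) auto
  then have "(density_bound * window_width k) ^ card (window_edges k) \<le> 1"
    using d w by (intro power_le_one) auto
  then show "good_prob k < 1"
    by (simp add: good_prob_def)
  show "0 < good_prob k"
    using d w by (simp add: good_prob_def)
qed

section \<open>The wall in the limit\<close>

lemma eventually_window:
  assumes "a \<in> lattice_edges" and p: "filterlim p at_top sequentially"
  shows "\<forall>\<^sub>F j in sequentially. a \<in> window_edges (p j) \<and> a \<subseteq> C (p j - 1) (p j)"
proof -
  obtain N where N: "\<And>k. N \<le> k \<Longrightarrow> a \<subseteq> C (k - 1) k"
  proof (cases rule: lattice_edges_cases[OF assms(1)])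
    case (1 i j)
    show thesis
      by (rule that[of "nat (\<bar>i\<bar> + \<bar>j\<bar> + 2)"]) (auto simp: 1 hedge_def)
  next
    case (2 i j)
    show thesis
      by (rule that[of "nat (\<bar>i\<bar> + \<bar>j\<bar> + 2)"]) (auto simp: 2 vedge_def)
  qed
  have "a \<in> window_edges k" if "N \<le> k" for k
  proof -
    have "C (k - 1) k \<subseteq> C k k"
      by (auto simp: C_def)
    moreover have "a \<noteq> {}"
      using assms(1) by (auto simp: lattice_edges_def)
    ultimately show ?thesis
      using N[OF that] assms(1) by (auto simp: window_edges_def induced_edges_def)
  qed
  then have "\<And>k. N \<le> k \<Longrightarrow> a \<in> window_edges k \<and> a \<subseteq> C (k - 1) k"
    using N by blast
  moreover have "\<forall>\<^sub>F j in sequentially. N \<le> p j"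
    using p by (simp add: filterlim_at_top)
  ultimately show ?thesis
    by (rule eventually_mono[rotated])
qed

lemma prescribed_couplings_tendsto:
  assumes "\<And>j. prescribed \<sigma> (p j) (J j)" and p: "filterlim p at_top sequentially"
  shows "couplings_tendsto J (\<lambda>a. \<sigma> * base_coupling a)"
  unfolding couplings_tendsto_def
proof
  fix a
  assume a: "a \<in> lattice_edges"
  have width: "window_width = (\<lambda>k. inverse (real (Suc k)) * (1 / 8))"
    by (simp add: fun_eq_iff window_width_def field_simps)
  have "(\<lambda>j. window_width (p j)) \<longlonglongrightarrow> 0"
  proof (rule filterlim_compose[OF _ p])
    show "window_width \<longlonglongrightarrow> 0"
      unfolding width by (rule tendsto_mult_left_zero[OF LIMSEQ_inverse_real_of_nat])
  qed
  then have upper: "(\<lambda>j. \<sigma> * (base_coupling a + window_width (p j))) \<longlonglongrightarrow> \<sigma> * (base_coupling a + 0)"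
    by (intro tendsto_intros)
  have "\<forall>\<^sub>F j in sequentially. \<sigma> * base_coupling a \<le> J j a \<and>
      J j a \<le> \<sigma> * (base_coupling a + window_width (p j))"
    using eventually_window[OF a p]
  proof eventually_elim
    case (elim j)
    then show ?case
      using assms(1)[of j] by (auto simp: prescribed_def window_low_def)
  qed
  then have "\<forall>\<^sub>F j in sequentially. \<sigma> * base_coupling a \<le> J j a"
    and "\<forall>\<^sub>F j in sequentially. J j a \<le> \<sigma> * (base_coupling a + window_width (p j))"
    by (simp_all add: eventually_conj_iff)
  then show "(\<lambda>j. J j a) \<longlonglongrightarrow> \<sigma> * base_coupling a"
    using tendsto_sandwich[OF _ _ tendsto_const upper] by simp
qed

text \<open>The spin \<open>s0\<close> may vary with \<open>n\<close>, but it occurs twice in the product over an edge.\<close>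

lemma window_states_tendsto:
  fixes s :: "nat \<Rightarrow> state" and \<tau> :: real
  assumes s: "\<And>n. \<exists>s0. (s0 = 1 \<or> s0 = -1) \<and> (\<forall>i j. \<bar>i\<bar> \<le> int (p n) \<longrightarrow> \<bar>j\<bar> < int (p n) \<longrightarrow>
      s n (i, j) = (if i \<le> 0 then s0 else \<tau> * s0))"
    and p: "filterlim p at_top sequentially" and p_pos: "\<And>n. 0 < p n"
  shows "states_tendsto s (\<lambda>v. if fst v \<le> 0 then 1 else \<tau>)"
  unfolding states_tendsto_def
proof
  fix a
  assume a: "a \<in> lattice_edges"
  show "\<forall>\<^sub>F n in sequentially. spin_product (s n) a = spin_product (\<lambda>v. if fst v \<le> 0 then 1 else \<tau>) a"
    using eventually_window[OF a p]
  proof eventually_elim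
    case (elim n)
    obtain s0 where s0: "s0 = 1 \<or> s0 = -1"
      "\<And>i j. \<bar>i\<bar> \<le> int (p n) \<Longrightarrow> \<bar>j\<bar> < int (p n) \<Longrightarrow> s n (i, j) = (if i \<le> 0 then s0 else \<tau> * s0)"
      using s[of n] by blast
    have val: "s n v = s0 * (if fst v \<le> 0 then 1 else \<tau>)" if "v \<in> a" for v
    proof -
      obtain i j where v: "v = (i, j)"
        by fastforce
      have "\<bar>i\<bar> \<le> int (p n) \<and> \<bar>j\<bar> \<le> int (p n - 1)"
        using elim that by (auto simp: v)
      then show ?thesis
        using s0(2)[of i j] p_pos[of n] by (auto simp: v)
    qed
    have sq: "s0 * s0 = 1"
      using s0(1) by auto
    have "spin_product (s n) {u, v} = spin_product (\<lambda>v. if fst v \<le> 0 then 1 else \<tau>) {u, v}"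
      if "a = {u, v}" "u \<noteq> v" for u v
      using val[of u] val[of v] that sq by (simp add: spin_product_pair mult.left_commute mult.assoc)
    moreover have "\<exists>u v. a = {u, v} \<and> u \<noteq> v"
      using a unfolding lattice_edges_def by force
    ultimately show ?case
      by blast
  qed
qed

text \<open>All couplings being ferromagnetic, the two states differ on the edges \<open>hedge 0 j\<close> only, whose
  dual edges join \<open>(0, j - 1)\<close> to \<open>(0, j)\<close>. They form a vertical line.\<close>

lemma finitely_incongruent_centre:
  assumes "\<And>a. 0 < K a"
  shows "finitely_incongruent K (\<lambda>v. if fst v \<le> 0 then 1 else -1) (\<lambda>v. 1)"
proof -
  let ?o = "\<lambda>v :: vertex. if fst v \<le> 0 then 1 else -1 :: real" and ?e = "\<lambda>v :: vertex. 1 :: real"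
  define F where "F = wall_edges K ?o ?e"
  have F: "{(0, j), (0, j + 1)} \<in> F" for j :: int
  proof -
    have "dual_edge (hedge 0 (j + 1)) = {(0, j), (0, j + 1)}"
      by (auto simp: dual_edge_def unit_square_def hedge_def)
    moreover have "satisfied K ?o (hedge 0 (j + 1)) \<noteq> satisfied K ?e (hedge 0 (j + 1))"
      using assms[of "hedge 0 (j + 1)"] by (simp add: satisfied_def)
    ultimately show ?thesis
      unfolding F_def wall_edges_def by (intro image_eqI[of _ _ "hedge 0 (j + 1)"]) simp_all
  qed
  define g where "g n = (0 :: int, n :: int)" for n
  let ?conn = "{(x, y). {x, y} \<in> F}"
  have conn: "(g 0, g n) \<in> ?conn\<^sup>*" for n
  proof (induction n rule: int_induct[where k = 0])
    case (step1 n)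
    have "(g n, g (n + 1)) \<in> ?conn"
      using F[of n] by (simp add: g_def)
    then show ?case
      using step1 by (meson rtrancl.rtrancl_into_rtrancl)
  next
    case (step2 n)
    have "(g n, g (n - 1)) \<in> ?conn"
      using F[of "n - 1"] by (simp add: g_def insert_commute)
    then show ?case
      using step2 by (meson rtrancl.rtrancl_into_rtrancl)
  qed simp
  have wall: "edge_component F (g 0) \<in> domain_walls K ?o ?e"
    unfolding domain_walls_def F_def[symmetric] using F[of 0] by (auto simp: g_def)
  have path: "{g n, g (n + 1)} \<in> edge_component F (g 0)" for n
    unfolding edge_component_def using F[of n] conn[of n] by (auto simp: g_def)
  have unbounded: "\<not> bounded (g ` S)" if S: "\<And>m :: int. \<exists>n\<in>S. m \<le> \<bar>n\<bar>" for S
  proof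
    assume "bounded (g ` S)"
    then obtain x :: "real \<times> real" and e where e: "\<And>n. n \<in> S \<Longrightarrow> dist x (0, real_of_int n) \<le> e"
      by (auto simp: bounded_def g_def)
    obtain n where n: "n \<in> S" "\<lceil>\<bar>snd x\<bar> + e\<rceil> + 1 \<le> \<bar>n\<bar>"
      using S by blast
    have "\<bar>snd x - real_of_int n\<bar> \<le> e"
      using dist_snd_le[of x "(0, real_of_int n)"] e[OF n(1)] by (simp add: dist_real_def)
    then have "\<bar>real_of_int n\<bar> \<le> \<bar>snd x\<bar> + e"
      by linarith
    then show False
      using n(2) by linarith
  qed
  have "\<not> bounded (g ` {0..})"
  proof (rule unbounded)
    show "\<exists>n\<in>{0..}. m \<le> \<bar>n\<bar>" for m :: int
      by (rule bexI[of _ "\<bar>m\<bar>"]) auto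
  qed
  moreover have "\<not> bounded (g ` {..0})"
  proof (rule unbounded)
    show "\<exists>n\<in>{..0}. m \<le> \<bar>n\<bar>" for m :: int
      by (rule bexI[of _ "- \<bar>m\<bar>"]) auto
  qed
  moreover have "inj g"
    by (simp add: g_def inj_def)
  ultimately show ?thesis
    unfolding finitely_incongruent_def using wall path by blast
qed

text \<open>The relative sign of the two sides is \<open>1\<close> for height \<open>l\<close> and \<open>-1\<close> for height \<open>l - 1\<close>.\<close>

lemma good_groundstates:
  assumes k: "0 < k" "k < l" and \<sigma>: "0 < \<sigma>" and J: "good \<sigma> l k J"
  shows "c_groundstate J l k s \<Longrightarrow> \<exists>s0. (s0 = 1 \<or> s0 = -1) \<and>
      (\<forall>i j. \<bar>i\<bar> \<le> int k \<longrightarrow> \<bar>j\<bar> < int k \<longrightarrow> s (i, j) = (if i \<le> 0 then s0 else 1 * s0))"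
    and "c_groundstate J (l - 1) k s \<Longrightarrow> \<exists>s0. (s0 = 1 \<or> s0 = -1) \<and>
      (\<forall>i j. \<bar>i\<bar> \<le> int k \<longrightarrow> \<bar>j\<bar> < int k \<longrightarrow> s (i, j) = (if i \<le> 0 then s0 else -1 * s0))"
proof -
  have presc: "prescribed \<sigma> k J"
    and sign: "\<And>h. h \<in> flip_heights l \<Longrightarrow> 0 < required_sign l h * half_product J k h"
    using J by (auto simp: good_def)
  have l: "int (l - 1) = int l - 1" "- int (l - 1) = 1 - int l"
    using k by auto
  have "0 < 1 * half_product J k (int l)" "0 < 1 * half_product J k (- int l)"
    using sign[of "int l"] sign[of "- int l"] by (simp_all add: flip_heights_def required_sign_def)
  then show "\<exists>s0. (s0 = 1 \<or> s0 = -1) \<and>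
      (\<forall>i j. \<bar>i\<bar> \<le> int k \<longrightarrow> \<bar>j\<bar> < int k \<longrightarrow> s (i, j) = (if i \<le> 0 then s0 else 1 * s0))"
    if "c_groundstate J l k s"
    using groundstate_on_window[OF k(1) less_imp_le[OF k(2)] \<sigma> presc _ _ _ that] by blast
  have "0 < -1 * half_product J k (int (l - 1))" "0 < -1 * half_product J k (- int (l - 1))"
    using sign[of "int l - 1"] sign[of "1 - int l"] k unfolding l
    by (auto simp: flip_heights_def required_sign_def split: if_splits)
  moreover have "k \<le> l - 1"
    using k by simp
  ultimately show "\<exists>s0. (s0 = 1 \<or> s0 = -1) \<and>
      (\<forall>i j. \<bar>i\<bar> \<le> int k \<longrightarrow> \<bar>j\<bar> < int k \<longrightarrow> s (i, j) = (if i \<le> 0 then s0 else -1 * s0))"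
    if "c_groundstate J (l - 1) k s"
    using groundstate_on_window[OF k(1) _ \<sigma> presc _ _ _ that] by blast
qed

text \<open>Every level \<open>k\<close> is attained only finitely often, hence the windows of the good assignments
  exhaust the lattice. On the windows the couplings converge and the
  groundstates are known up to reversal.\<close>

lemma good_subsequence:
  fixes l p :: "nat \<Rightarrow> nat" and J :: "nat \<Rightarrow> coupling"
  assumes pl: "\<And>i. 0 < p i" "\<And>i. p i < l i" and \<sigma>: "0 < \<sigma>"
    and fibres: "\<And>k. finite {i. p i = k}"
    and good: "\<exists>\<^sub>\<infinity>i. good \<sigma> (l i) (p i) (J i)"
  shows "\<exists>m :: nat \<Rightarrow> nat. strict_mono m \<and>
          (\<exists>K. couplings_tendsto (\<lambda>j. J (m j)) K \<and>
            (\<forall>es os :: nat \<Rightarrow> state.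
              (\<forall>j. c_groundstate (J (m j)) (l (m j)) (p (m j)) (es j)) \<longrightarrow>
              (\<forall>j. c_groundstate (J (m j)) (l (m j) - 1) (p (m j)) (os j)) \<longrightarrow>
              (\<exists>e'\<in>states UNIV. \<exists>o'\<in>states UNIV.
                states_tendsto es e' \<and> states_tendsto os o' \<and>
                finitely_incongruent K o' e')))"
proof -
  let ?G = "{i. good \<sigma> (l i) (p i) (J i)}"
  have inf: "infinite ?G"
    using good by (simp add: frequently_cofinite)
  define m where "m = enumerate ?G"
  have m: "strict_mono m"
    unfolding m_def using inf by (rule strict_mono_enumerate)
  have good_m: "good \<sigma> (l (m j)) (p (m j)) (J (m j))" for j
    using enumerate_in_set[OF inf, of j] by (simp add: m_def)
  have "filterlim p at_top sequentially"
    unfolding filterlim_at_top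
  proof
    fix Z
    have "{i. \<not> Z \<le> p i} = (\<Union>k<Z. {i. p i = k})"
      by auto
    then have "finite {i. \<not> Z \<le> p i}"
      using fibres by simp
    then show "\<forall>\<^sub>F i in sequentially. Z \<le> p i"
      by (simp add: eventually_cofinite flip: cofinite_eq_sequentially)
  qed
  then have pm: "filterlim (\<lambda>j. p (m j)) at_top sequentially"
    using filterlim_subseq[OF m] by (rule filterlim_compose)
  let ?K = "\<lambda>a. \<sigma> * base_coupling a"
  let ?e = "\<lambda>v :: vertex. if fst v \<le> 0 then 1 else 1 :: real"
  let ?o = "\<lambda>v :: vertex. if fst v \<le> 0 then 1 else -1 :: real"
  have "couplings_tendsto (\<lambda>j. J (m j)) ?K"
    using good_m pm by (intro prescribed_couplings_tendsto[where p = "\<lambda>j. p (m j)"])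
      (auto simp: good_def)
  moreover have "states_tendsto es ?e"
    if es: "\<forall>j. c_groundstate (J (m j)) (l (m j)) (p (m j)) (es j)" for es
    using good_groundstates(1)[OF pl \<sigma> good_m] es pl pm
    by (intro window_states_tendsto[where p = "\<lambda>j. p (m j)"]) blast+
  moreover have "states_tendsto os ?o"
    if os: "\<forall>j. c_groundstate (J (m j)) (l (m j) - 1) (p (m j)) (os j)" for os
    using good_groundstates(2)[OF pl \<sigma> good_m] os pl pm
    by (intro window_states_tendsto[where p = "\<lambda>j. p (m j)"]) blast+
  moreover have "finitely_incongruent ?K ?o ?e"
    using finitely_incongruent_centre[of ?K] \<sigma> base_coupling_bounds(1) by simp
  moreover have "?e \<in> states UNIV" "?o \<in> states UNIV"
    by (auto simp: states_def split: if_splits)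
  ultimately show ?thesis
    using m by blast
qed

section \<open>Infinitely many good assignments\<close>

lemma enough_trials: "\<exists>n>0. (1 - good_prob k) ^ n \<le> (1 / 2) ^ k"
proof -
  have "0 \<le> 1 - good_prob k" "1 - good_prob k < 1"
    using good_prob_bounds[of k] by auto
  then have "(\<lambda>n. (1 - good_prob k) ^ n) \<longlonglongrightarrow> 0"
    by (intro LIMSEQ_realpow_zero) auto
  then have "\<forall>\<^sub>F n in sequentially. (1 - good_prob k) ^ n < (1 / 2) ^ k"
    by (rule order_tendstoD) simp
  moreover have "\<forall>\<^sub>F n in sequentially. 0 < n"
    by (rule eventually_gt_at_top)
  ultimately have "\<forall>\<^sub>F n in sequentially. 0 < n \<and> (1 - good_prob k) ^ n < (1 / 2) ^ k"
    by eventually_elim simp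
  then show ?thesis
    by (auto simp: eventually_sequentially intro: less_imp_le)
qed

text \<open>With this many independent trials the probability of having no good assignment is summable over
  \<open>k\<close>.\<close>

definition trials :: "nat \<Rightarrow> nat" where
  "trials k = (SOME n. 0 < n \<and> (1 - good_prob k) ^ n \<le> (1 / 2) ^ k)"

lemma trials: "0 < trials k" "(1 - good_prob k) ^ trials k \<le> (1 / 2) ^ k"
  using someI_ex[OF enough_trials[of k]] by (simp_all add: trials_def)

lemma prob_space_gaussian_couplings:
  "0 < \<sigma> \<Longrightarrow> prob_space (gaussian_couplings \<sigma> l k)"
  unfolding gaussian_couplings_def by (intro prob_space_PiM prob_space_normal_density)

text \<open>The first Borel-Cantelli lemma applied to the events that no rectangle of width parameter
  \<open>n + 1\<close> receives a good assignment: by independence of the assignments these have probability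
  at most \<open>(1 / 2) ^ (n + 1)\<close>.\<close>

lemma AE_infinitely_many_good:
  fixes l p :: "nat \<Rightarrow> nat"
  assumes pl: "\<And>i. 0 < p i" "\<And>i. p i < l i" and \<sigma>: "0 < \<sigma>"
    and fibres: "\<And>k. 0 < k \<Longrightarrow> finite {i. p i = k}"
    and enough: "\<And>k. 0 < k \<Longrightarrow> trials k \<le> card {i. p i = k}"
  shows "AE J in (\<Pi>\<^sub>M i\<in>UNIV. gaussian_couplings \<sigma> (l i) (p i)). \<exists>\<^sub>\<infinity>i. good \<sigma> (l i) (p i) (J i)"
proof -
  let ?G = "\<lambda>i. gaussian_couplings \<sigma> (l i) (p i)"
  interpret prob_space "?G i" for i
    by (rule prob_space_gaussian_couplings[OF \<sigma>])
  interpret P: product_prob_space ?G UNIV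
    by standard
  let ?M = "\<Pi>\<^sub>M i\<in>UNIV. ?G i"
  define A where "A i = {J \<in> space (?G i). good \<sigma> (l i) (p i) J}" for i
  have A: "A i \<in> sets (?G i)" for i
    unfolding A_def using pl[of i] by (intro sets_good) auto
  define B where "B n = {J \<in> space ?M. \<forall>i\<in>{i. p i = Suc n}. J i \<in> space (?G i) - A i}" for n
  have B_sets: "B n \<in> sets ?M" for n
  proof -
    have "{J \<in> space ?M. J i \<in> space (?G i) - A i} \<in> sets ?M" for i
    proof -
      have "(\<lambda>J. J i) -` (space (?G i) - A i) \<inter> space ?M \<in> sets ?M"
        using A by (intro measurable_sets[OF measurable_component_singleton]) auto
      then show ?thesis
        by (simp add: vimage_def Int_def conj_commute)
    qed
    then show ?thesis
      unfolding B_def by (rule sets.sets_Collect_finite_All) (rule fibres, simp)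
  qed
  have prob_B: "measure ?M (B n) \<le> (1 / 2) ^ Suc n" for n
  proof -
    let ?F = "{i. p i = Suc n}"
    have "emeasure ?M (B n) = (\<Prod>i\<in>?F. emeasure (?G i) (space (?G i) - A i))"
      unfolding B_def
    proof (rule P.emeasure_PiM_Collect)
      show "space (?G i) - A i \<in> sets (?G i)" for i
        using A[of i] by auto
    qed (use fibres in auto)
    also have "\<dots> \<le> (\<Prod>i\<in>?F. ennreal (1 - good_prob (Suc n)))"
    proof (rule ennreal_prod_mono)
      fix i
      assume "i \<in> ?F"
      then have "ennreal (good_prob (Suc n)) \<le> emeasure (?G i) (A i)"
        using good_prob_le[OF \<sigma> pl[of i]] by (simp add: A_def)
      then have "good_prob (Suc n) \<le> measure (?G i) (A i)"
        by (simp add: emeasure_eq_measure)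
      then show "emeasure (?G i) (space (?G i) - A i) \<le> ennreal (1 - good_prob (Suc n))"
        using prob_compl[OF A[of i]] by (simp add: emeasure_eq_measure ennreal_leI)
    qed
    also have "\<dots> = ennreal ((1 - good_prob (Suc n)) ^ card ?F)"
      using good_prob_bounds[of "Suc n"] by (simp add: ennreal_power)
    also have "\<dots> \<le> ennreal ((1 / 2) ^ Suc n)"
    proof (rule ennreal_leI)
      have "(1 - good_prob (Suc n)) ^ card ?F \<le> (1 - good_prob (Suc n)) ^ trials (Suc n)"
        using good_prob_bounds[of "Suc n"] enough[of "Suc n"] by (intro power_decreasing) auto
      then show "(1 - good_prob (Suc n)) ^ card ?F \<le> (1 / 2) ^ Suc n"
        using trials(2)[of "Suc n"] by linarith
    qed
    finally show ?thesis
      by (simp add: P.emeasure_eq_measure)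
  qed
  have "AE J in ?M. \<forall>\<^sub>F n in sequentially. J \<in> space ?M - B n"
  proof (rule borel_cantelli_AE1)
    have "summable (\<lambda>n. (1 / 2 :: real) ^ Suc n)"
      by (intro summable_Suc_iff[THEN iffD2] summable_geometric) simp
    then show "summable (\<lambda>n. measure ?M (B n))"
      by (rule summable_comparison_test'[where N = 0]) (use prob_B in simp)
  qed (use B_sets in \<open>auto simp: P.emeasure_eq_measure\<close>)
  moreover have "\<exists>\<^sub>\<infinity>i. good \<sigma> (l i) (p i) (J i)"
    if ev: "\<forall>\<^sub>F n in sequentially. J \<in> space ?M - B n" for J
  proof -
    obtain N where N: "\<And>n. N \<le> n \<Longrightarrow> J \<in> space ?M - B n"
      using ev by (auto simp: eventually_sequentially)
    have good_fibre: "\<exists>i. p i = Suc n \<and> good \<sigma> (l i) (p i) (J i)" if "N \<le> n" for n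
    proof -
      have "J i \<in> space (?G i)" for i
        using N[OF that] by (auto simp: space_PiM PiE_iff)
      moreover have "\<exists>i. p i = Suc n \<and> J i \<notin> space (?G i) - A i"
        using N[OF that] by (auto simp: B_def)
      ultimately show ?thesis
        by (auto simp: A_def)
    qed
    have "{Suc N..} \<subseteq> p ` {i. good \<sigma> (l i) (p i) (J i)}"
    proof
      fix k
      assume "k \<in> {Suc N..}"
      then obtain n where n: "k = Suc n" "N \<le> n"
        by (auto dest: Suc_le_D)
      obtain i where "p i = Suc n" "good \<sigma> (l i) (p i) (J i)"
        using good_fibre[OF n(2)] by blast
      then show "k \<in> p ` {i. good \<sigma> (l i) (p i) (J i)}"
        unfolding n(1) by (intro image_eqI[of _ _ i]) simp_all
    qed
    then have "infinite (p ` {i. good \<sigma> (l i) (p i) (J i)})"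
      using infinite_Ici infinite_super by blast
    then show ?thesis
      by (auto simp: frequently_cofinite)
  qed
  ultimately show ?thesis
    by (auto elim: eventually_mono)
qed

theorem theorem3:
  shows "\<exists>N :: nat \<Rightarrow> nat. (\<forall>k>0. N k > 0) \<and>
    (\<forall>(l :: nat \<Rightarrow> nat) (p :: nat \<Rightarrow> nat) (\<sigma> :: real).
      (\<forall>i. 0 < p i \<and> p i < l i) \<longrightarrow>
      nested_exhaustion (\<lambda>i. C (l i) (p i)) \<longrightarrow>
      (\<forall>k>0. N k \<le> card {i. p i = k}) \<longrightarrow>
      \<sigma> > 0 \<longrightarrow>
      (AE J in (\<Pi>\<^sub>M i\<in>UNIV. gaussian_couplings \<sigma> (l i) (p i)).
        \<exists>m :: nat \<Rightarrow> nat. strict_mono m \<and>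
          (\<exists>K. couplings_tendsto (\<lambda>j. J (m j)) K \<and>
            (\<forall>es os :: nat \<Rightarrow> state.
              (\<forall>j. c_groundstate (J (m j)) (l (m j)) (p (m j)) (es j)) \<longrightarrow>
              (\<forall>j. c_groundstate (J (m j)) (l (m j) - 1) (p (m j)) (os j)) \<longrightarrow>
              (\<exists>e'\<in>states UNIV. \<exists>o'\<in>states UNIV.
                states_tendsto es e' \<and> states_tendsto os o' \<and>
                finitely_incongruent K o' e')))))"
proof (intro exI[of _ trials] conjI allI impI trials(1))
  fix l p :: "nat \<Rightarrow> nat" and \<sigma> :: real
  assume pl: "\<forall>i. 0 < p i \<and> p i < l i" and \<sigma>: "\<sigma> > 0"
    and card: "\<forall>k>0. trials k \<le> card {i. p i = k}"
  \<comment> \<open>An infinite fibre would have cardinality \<open>0\<close>, below the number of trials.\<close>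
  have fibres: "finite {i. p i = k}" for k
  proof (cases "k = 0")
    case True
    then show ?thesis
      using pl less_numeral_extra(3) by (metis (mono_tags, lifting) Collect_empty_eq finite.emptyI)
  next
    case False
    then show ?thesis
      using card trials(1)[of k] by (metis card.infinite gr0I not_less)
  qed
  have "AE J in (\<Pi>\<^sub>M i\<in>UNIV. gaussian_couplings \<sigma> (l i) (p i)). \<exists>\<^sub>\<infinity>i. good \<sigma> (l i) (p i) (J i)"
    using pl \<sigma> fibres card by (intro AE_infinitely_many_good) auto
  then show "AE J in (\<Pi>\<^sub>M i\<in>UNIV. gaussian_couplings \<sigma> (l i) (p i)).
        \<exists>m :: nat \<Rightarrow> nat. strict_mono m \<and>
          (\<exists>K. couplings_tendsto (\<lambda>j. J (m j)) K \<and>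
            (\<forall>es os :: nat \<Rightarrow> state.
              (\<forall>j. c_groundstate (J (m j)) (l (m j)) (p (m j)) (es j)) \<longrightarrow>
              (\<forall>j. c_groundstate (J (m j)) (l (m j) - 1) (p (m j)) (os j)) \<longrightarrow>
              (\<exists>e'\<in>states UNIV. \<exists>o'\<in>states UNIV.
                states_tendsto es e' \<and> states_tendsto os o' \<and>
                finitely_incongruent K o' e')))"
  proof (rule eventually_mono)
    fix J
    assume "\<exists>\<^sub>\<infinity>i. good \<sigma> (l i) (p i) (J i)"
    then show "\<exists>m :: nat \<Rightarrow> nat. strict_mono m \<and>
          (\<exists>K. couplings_tendsto (\<lambda>j. J (m j)) K \<and>
            (\<forall>es os :: nat \<Rightarrow> state.
              (\<forall>j. c_groundstate (J (m j)) (l (m j)) (p (m j)) (es j)) \<longrightarrow>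
              (\<forall>j. c_groundstate (J (m j)) (l (m j) - 1) (p (m j)) (os j)) \<longrightarrow>
              (\<exists>e'\<in>states UNIV. \<exists>o'\<in>states UNIV.
                states_tendsto es e' \<and> states_tendsto os o' \<and>
                finitely_incongruent K o' e')))"
      using pl \<sigma> fibres by (intro good_subsequence[where \<sigma> = \<sigma>]) auto
  qed
qed

end
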